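(* Let $n\geq 1$ and let $\varpi_0=(n,n-1,\ldots,1)$ be the longest element of $S_n$. The reverse double Schubert polynomial $\widetilde{\mathfrak S}_{\varpi_0}(Y,Z)$ satisfies $$\widetilde{\mathfrak S}_{\varpi_0}(Y,Z)=S^{(\delta^\vee_{n-1},\delta^\vee_{n-1})}_{\delta_{n-1}}(h(Y,-Z)):=\det\Bigl(h_{n-i+j-i}(y_1,\ldots,y_i,-z_1,\ldots,-z_i)\Bigr)_{1\leq i,j\leq n-1}.$$
   Context: $Y=(y_1,y_2,\ldots)$ and $Z=(z_1,z_2,\ldots)$ are commuting independent variables and $-Z=(-z_1,-z_2,\ldots)$. The nilCoxeter algebra $\mathcal N_n$ of $S_n$ is the free associative unital algebra on $u_1,\ldots,u_{n-1}$ modulo $u_i^2=0$; $u_iu_j=u_ju_i$ for $|i-j|\geq 2$; $u_iu_{i+1}u_i=u_{i+1}u_iu_{i+1}$. It has a basis $u_\varpi=u_{a_1}\cdots u_{a_\ell}$, $\varpi\in S_n$, where $a_1\cdots a_\ell$ is any reduced word of $\varpi$; $\langle\xi,\varpi\rangle$ is the coefficient of $u_\varpi$ in $\xi$ (coefficients extended to polynomials in the variables). Let $A_i(t)=(1+tu_{n-1})(1+tu_{n-2})\cdots(1+tu_i)$. The (single) Schubert polynomial of $\varpi\in S_n$ is $\mathfrak S_\varpi(Y)=\langle A_1(y_1)\cdots A_{n-1}(y_{n-1}),\varpi\rangle$; it is independent of the choice of $n$ with $\varpi\in S_n$. A reduced factorization $uv=\varpi$ is a factorization with $\ell(u)+\ell(v)=\ell(\varpi)$.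 The reverse double Schubert polynomial of $\varpi$ is $$\widetilde{\mathfrak S}_\varpi(Y,Z):=\sum_{uv=\varpi}\mathfrak S_u(Y)\,\mathfrak S_{v^{-1}}(-Z),$$ the sum over all reduced factorizations $uv=\varpi$. $\delta_{n-1}=(n-1,\ldots,1)$, $\delta_{n-1}^\vee=(1,2,\ldots,n-1)$; $h_p$ is the complete homogeneous symmetric polynomial of degree $p$ ($h_0=1$, $h_p=0$ for $p<0$). An empty determinant is $1$. *)

theory Defs
  imports
    "HOL-Library.Poly_Mapping"
    "HOL-Combinatorics.Permutations"
    "HOL-Algebra.QuotRing"
    "Jordan_Normal_Form.Determinant"
begin

section \<open>The symmetric group\<close>

text \<open>
  \<open>S\<^sub>n\<close> consists of the functions permuting \<open>{1..n}\<close>; the group operation is composition of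
  functions, so the word \<open>a\<^sub>1 \<dots> a\<^sub>l\<close> represents \<open>s\<^bsub>a\<^sub>1\<^esub> \<circ> \<dots> \<circ> s\<^bsub>a\<^sub>l\<^esub>\<close>.
\<close>

definition symgrp :: "nat \<Rightarrow> (nat \<Rightarrow> nat) set" where
  "symgrp n = {w. w permutes {1..n}}"

definition word_perm :: "nat list \<Rightarrow> nat \<Rightarrow> nat" where
  "word_perm as = foldr (\<lambda>a w. Transposition.transpose a (Suc a) \<circ> w) as id"

definition perm_length :: "nat \<Rightarrow> (nat \<Rightarrow> nat) \<Rightarrow> nat" where
  "perm_length n w = (LEAST l. \<exists>as. set as \<subseteq> {1..<n} \<and> word_perm as = w \<and> length as = l)"

definition reduced_word :: "nat \<Rightarrow> (nat \<Rightarrow> nat) \<Rightarrow> nat list \<Rightarrow> bool" where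
  "reduced_word n w as \<longleftrightarrow>
     set as \<subseteq> {1..<n} \<and> word_perm as = w \<and> length as = perm_length n w"

definition reduced_factorizations ::
    "nat \<Rightarrow> (nat \<Rightarrow> nat) \<Rightarrow> ((nat \<Rightarrow> nat) \<times> (nat \<Rightarrow> nat)) set" where
  "reduced_factorizations n w =
     {(u, v). u \<in> symgrp n \<and> v \<in> symgrp n \<and> u \<circ> v = w \<and>
              perm_length n u + perm_length n v = perm_length n w}"

definition longest_perm :: "nat \<Rightarrow> nat \<Rightarrow> nat" where
  "longest_perm n = (\<lambda>i. if i \<in> {1..n} then n + 1 - i else i)"

section \<open>The nilCoxeter algebra\<close>

text \<open>
  Words form a monoid under concatenation (written additively, as the convolution product on
  \<open>\<Rightarrow>\<^sub>0\<close> requires), so that \<open>gen_word \<Rightarrow>\<^sub>0 'r\<close> is the free associative unital \<open>'r\<close>-algebra on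
  generators indexed by the natural numbers.
\<close>

datatype gen_word = Word (letters: "nat list")

instantiation gen_word :: monoid_add
begin

definition zero_gen_word :: gen_word where
  "0 = Word []"

definition plus_gen_word :: "gen_word \<Rightarrow> gen_word \<Rightarrow> gen_word" where
  "v + w = Word (letters v @ letters w)"

instance
  by standard (simp_all add: zero_gen_word_def plus_gen_word_def)

end

definition free_alg :: "nat \<Rightarrow> (gen_word \<Rightarrow>\<^sub>0 'r::comm_ring_1) ring" where
  "free_alg n =
     \<lparr>carrier = {f. \<forall>w \<in> Poly_Mapping.keys f. set (letters w) \<subseteq> {1..<n}},
      monoid.mult = (*), monoid.one = 1, ring.zero = 0, ring.add = (+)\<rparr>"

text \<open>\<open>genideal\<close> is an intersection over two-sided ideals of a ring, hence meaningful only
  because of the following fact.\<close>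

lemma ring_free_alg: "ring (free_alg n :: (gen_word \<Rightarrow>\<^sub>0 'r::comm_ring_1) ring)"
proof -
  let ?F = "free_alg n :: (gen_word \<Rightarrow>\<^sub>0 'r) ring"
  define C where "C = {f :: gen_word \<Rightarrow>\<^sub>0 'r. \<forall>w \<in> Poly_Mapping.keys f. set (letters w) \<subseteq> {1..<n}}"
  have F: "?F = \<lparr>carrier = C, monoid.mult = (*), monoid.one = 1, ring.zero = 0, ring.add = (+)\<rparr>"
    by (simp only: free_alg_def C_def)
  have plus: "f + g \<in> C" if "f \<in> C" "g \<in> C" for f g
    using that Poly_Mapping.keys_add[of f g] unfolding C_def by blast
  have neg: "- f \<in> C" if "f \<in> C" for f
    using that unfolding C_def by (simp add: Poly_Mapping.in_keys_iff)
  have times: "f * g \<in> C" if fg: "f \<in> C" "g \<in> C" for f g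
    unfolding C_def
  proof (intro CollectI ballI)
    fix w assume "w \<in> Poly_Mapping.keys (f * g)"
    then obtain u v where "u \<in> Poly_Mapping.keys f" "v \<in> Poly_Mapping.keys g" "w = u + v"
      using Poly_Mapping.keys_mult[of f g] by blast
    then show "set (letters w) \<subseteq> {1..<n}"
      using fg unfolding C_def by (simp add: plus_gen_word_def)
  qed
  have zero: "0 \<in> C"
    unfolding C_def by simp
  have one: "1 \<in> C"
    unfolding C_def by (simp add: zero_gen_word_def)
  have "abelian_group ?F"
  proof (rule abelian_groupI)
    show "\<exists>y\<in>carrier ?F. y \<oplus>\<^bsub>?F\<^esub> x = \<zero>\<^bsub>?F\<^esub>" if "x \<in> carrier ?F" for x
      using that neg[of x] unfolding F by (intro bexI[of _ "- x"]) simp_all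
  qed (simp_all add: F plus zero ac_simps)
  moreover have "Group.monoid ?F"
    by (rule Group.monoidI) (simp_all add: F times one mult.assoc)
  ultimately show ?thesis
    by (rule ringI) (simp_all add: F distrib_left distrib_right)
qed

definition word_elt :: "nat list \<Rightarrow> gen_word \<Rightarrow>\<^sub>0 'r::comm_ring_1" where
  "word_elt as = Poly_Mapping.single (Word as) 1"

definition nilcoxeter_rels :: "nat \<Rightarrow> (gen_word \<Rightarrow>\<^sub>0 'r::comm_ring_1) set" where
  "nilcoxeter_rels n =
     {word_elt [i, i] | i. i \<in> {1..<n}}
     \<union> {word_elt [i, j] - word_elt [j, i] | i j.
          i \<in> {1..<n} \<and> j \<in> {1..<n} \<and> (i + 2 \<le> j \<or> j + 2 \<le> i)}
     \<union> {word_elt [i, i + 1, i] - word_elt [i + 1, i, i + 1] | i.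
          i \<in> {1..<n} \<and> i + 1 \<in> {1..<n}}"

definition nilcoxeter_ideal :: "nat \<Rightarrow> (gen_word \<Rightarrow>\<^sub>0 'r::comm_ring_1) set" where
  "nilcoxeter_ideal n = genideal (free_alg n) (nilcoxeter_rels n)"

definition nilcoxeter :: "nat \<Rightarrow> (gen_word \<Rightarrow>\<^sub>0 'r::comm_ring_1) set ring" where
  "nilcoxeter n = free_alg n Quot nilcoxeter_ideal n"

definition nc_class :: "nat \<Rightarrow> (gen_word \<Rightarrow>\<^sub>0 'r::comm_ring_1) \<Rightarrow> (gen_word \<Rightarrow>\<^sub>0 'r) set" where
  "nc_class n f = nilcoxeter_ideal n +>\<^bsub>free_alg n\<^esub> f"

definition nc_gen :: "nat \<Rightarrow> nat \<Rightarrow> (gen_word \<Rightarrow>\<^sub>0 'r::comm_ring_1) set" where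
  "nc_gen n i = nc_class n (word_elt [i])"

definition nc_smult ::
    "nat \<Rightarrow> 'r \<Rightarrow> (gen_word \<Rightarrow>\<^sub>0 'r::comm_ring_1) set \<Rightarrow> (gen_word \<Rightarrow>\<^sub>0 'r) set" where
  "nc_smult n t \<xi> = nc_class n (Poly_Mapping.single 0 t) \<otimes>\<^bsub>nilcoxeter n\<^esub> \<xi>"

text \<open>Ordered (noncommutative) product of a list.\<close>

definition nc_prod ::
    "nat \<Rightarrow> (gen_word \<Rightarrow>\<^sub>0 'r::comm_ring_1) set list \<Rightarrow> (gen_word \<Rightarrow>\<^sub>0 'r) set" where
  "nc_prod n xs = foldr (\<lambda>x p. x \<otimes>\<^bsub>nilcoxeter n\<^esub> p) xs \<one>\<^bsub>nilcoxeter n\<^esub>"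

text \<open>\<open>u\<^sub>w\<close>, which does not depend on the reduced word that is chosen.\<close>

definition nc_basis :: "nat \<Rightarrow> (nat \<Rightarrow> nat) \<Rightarrow> (gen_word \<Rightarrow>\<^sub>0 'r::comm_ring_1) set" where
  "nc_basis n w = nc_prod n (map (nc_gen n) (SOME as. reduced_word n w as))"

text \<open>\<open>\<langle>\<xi>, w\<rangle>\<close>, well defined since the \<open>u\<^sub>v\<close> with \<open>v \<in> S\<^sub>n\<close> form a basis.\<close>

definition nc_coeff ::
    "nat \<Rightarrow> (gen_word \<Rightarrow>\<^sub>0 'r::comm_ring_1) set \<Rightarrow> (nat \<Rightarrow> nat) \<Rightarrow> 'r" where
  "nc_coeff n \<xi> w =
     (THE r. \<exists>c. c w = r \<and>
        \<xi> = (\<Oplus>\<^bsub>nilcoxeter n\<^esub> v \<in> symgrp n. nc_smult n (c v) (nc_basis n v)))"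

section \<open>Schubert polynomials\<close>

definition nc_A :: "nat \<Rightarrow> nat \<Rightarrow> 'r \<Rightarrow> (gen_word \<Rightarrow>\<^sub>0 'r::comm_ring_1) set" where
  "nc_A n i t =
     nc_prod n (map (\<lambda>j. \<one>\<^bsub>nilcoxeter n\<^esub> \<oplus>\<^bsub>nilcoxeter n\<^esub> nc_smult n t (nc_gen n j)) (rev [i..<n]))"

text \<open>
  The coefficient ring \<open>'r\<close> is a polynomial ring in applications, and \<open>x\<close> is the sequence that
  is put in for the variables: \<open>Y\<close>, or \<open>-Z\<close>.
\<close>

definition schubert :: "nat \<Rightarrow> (nat \<Rightarrow> nat) \<Rightarrow> (nat \<Rightarrow> 'r::comm_ring_1) \<Rightarrow> 'r" where
  "schubert n w x = nc_coeff n (nc_prod n (map (\<lambda>i. nc_A n i (x i)) [1..<n])) w"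

definition rev_double_schubert ::
    "nat \<Rightarrow> (nat \<Rightarrow> nat) \<Rightarrow> (nat \<Rightarrow> 'r::comm_ring_1) \<Rightarrow> (nat \<Rightarrow> 'r) \<Rightarrow> 'r" where
  "rev_double_schubert n w y z =
     (\<Sum>(u, v) \<in> reduced_factorizations n w.
        schubert n u y * schubert n (Hilbert_Choice.inv v) (\<lambda>i. - z i))"

section \<open>Complete homogeneous polynomials and the polynomial ring\<close>

text \<open>\<open>h\<^sub>p(x\<^sub>1, \<dots>, x\<^sub>m)\<close>, as the sum over all exponent vectors of total degree \<open>p\<close>.\<close>

definition complete_hom :: "int \<Rightarrow> 'r::comm_ring_1 list \<Rightarrow> 'r" where
  "complete_hom p xs =
     (if p < 0 then 0
      else (\<Sum>e \<in> {e :: nat list. length e = length xs \<and> sum_list e = nat p}.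
              \<Prod>k<length xs. (xs ! k) ^ (e ! k)))"

datatype yz_var = YVar nat | ZVar nat

type_synonym yz_poly = "(yz_var \<Rightarrow>\<^sub>0 nat) \<Rightarrow>\<^sub>0 int"

definition Yv :: "nat \<Rightarrow> yz_poly" where
  "Yv i = Poly_Mapping.single (Poly_Mapping.single (YVar i) 1) 1"

definition Zv :: "nat \<Rightarrow> yz_poly" where
  "Zv i = Poly_Mapping.single (Poly_Mapping.single (ZVar i) 1) 1"

text \<open>\<open>(y\<^sub>1, \<dots>, y\<^sub>i, -z\<^sub>1, \<dots>, -z\<^sub>i)\<close>\<close>

definition YnegZ :: "nat \<Rightarrow> yz_poly list" where
  "YnegZ i = map Yv [1..<i + 1] @ map (\<lambda>k. - Zv k) [1..<i + 1]"

text \<open>The entry in row \<open>i\<close> and column \<open>j\<close>, for \<open>1 \<le> i, j \<le> n - 1\<close>, is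
  \<open>h\<^bsub>n-i+j-i\<^esub>\<close> of these elements; the library indexes matrices from 0.\<close>

definition schubert_matrix :: "nat \<Rightarrow> yz_poly mat" where
  "schubert_matrix n =
     mat (n - 1) (n - 1)
       (\<lambda>(a, b). let i = a + 1; j = b + 1 in
          complete_hom (int n - int i + int j - int i) (YnegZ i))"

end

theory Submission
  imports Defs "HOL-Computational_Algebra.Formal_Power_Series"
begin

text \<open>
  Write \<open>S(Y) = A\<^sub>1(y\<^sub>1) \<dots> A\<^bsub>n-1\<^esub>(y\<^bsub>n-1\<^esub>)\<close>, and let \<open>*\<close> be the anti-automorphism of the nilCoxeter algebra
  that fixes the generators. Since \<open>u\<^sub>a u\<^sub>b\<close> is \<open>u\<^bsub>ab\<^esub>\<close> for a reduced factorization and zero otherwise,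
  the reverse double Schubert polynomial of \<open>w\<close> is the single coefficient \<open>\<langle>S(Y) S(-Z)\<^sup>*, w\<rangle>\<close>
  (\<open>rev_double_schubert_eq\<close>). For this the coefficient functionals have to be understood on the
  quotient algebra. On the free algebra \<open>\<langle>\<xi>, w\<rangle>\<close> is the sum of the coefficients of all reduced words of
  \<open>w\<close>; it is invariant under the relations, which gives the independence of the \<open>u\<^sub>w\<close>, and
  Matsumoto's theorem gives that they span (\<open>nc_coeff_class\<close>).

  The Yang-Baxter equation implies that \<open>A\<^sub>i(a)\<close> and \<open>A\<^sub>i(b)\<close> commute, and from this
  \<open>S(Y) (1 + (y\<^bsub>k+1\<^esub> - y\<^sub>k) u\<^sub>k) = S(s\<^sub>kY)\<close>. In other words \<open>S(Y) u\<^sub>k = \<partial>\<^sub>k S(Y)\<close> with the divided difference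
  operator in the variables \<open>Y\<close> (\<open>schubert_elt_difference\<close>). The coefficient in question is therefore
  obtained from \<open>\<langle>S(Y), w\<rangle>\<close> by applying operators \<open>1 + z\<partial>\<^sub>k\<close> with \<open>z = -z\<^sub>m\<close>. For the longest permutation the
  starting point is the monomial \<open>\<Prod>\<^sub>i y\<^sub>i\<^bsup>n-i\<^esup>\<close>, which equals the determinant of the
  \<open>h\<^bsub>n-2i+j\<^esub>(y\<^sub>1, \<dots>, y\<^sub>i)\<close> (\<open>row_det_staircase\<close>).

  Represent row \<open>i\<close> by its generating function \<open>R\<^sub>i = q\<^bsup>2i\<^esup> H\<^sub>i(q)\<close>, where \<open>H\<^sub>i\<close> is the product of the
  \<open>1 / (1 - xq)\<close> over the variables of the row. As \<open>\<partial>\<^sub>k (1 / (1 - y\<^sub>kq)) = q / ((1 - y\<^sub>kq)(1 - y\<^bsub>k+1\<^esub>q))\<close>, the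
  operators \<open>1 + z\<partial>\<^bsub>n-1\<^esub>, \<dots>, 1 + z\<partial>\<^sub>m\<close>, applied in this order, change the rows \<open>i \<ge> m\<close> one
  after the other, from \<open>q\<^bsup>2i\<^esup>H\<^sub>i\<close> to \<open>q\<^bsup>2i\<^esup>(H\<^sub>i + zqH\<^bsub>i+1\<^esub>)\<close>. If \<open>R'\<^sub>i = R\<^sub>i / (1 - zq)\<close> is the row with \<open>z\<close> as an
  additional variable, the new row is \<open>R'\<^sub>i + z(y\<^bsub>i+1\<^esub> - z)R'\<^bsub>i+1\<^esub>\<close> by \<open>geom_pair_identity\<close>, and the
  contribution of \<open>R'\<^sub>n\<close> to the last row vanishes for reasons of degree. So the determinant is that of
  the rows \<open>R'\<^sub>i\<close>. Repeating this for \<open>-z\<^sub>1, \<dots>, -z\<^bsub>n-1\<^esub>\<close> puts \<open>-z\<^sub>1, \<dots>, -z\<^sub>i\<close> into row \<open>i\<close>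
  (\<open>word_coeff_longest_dual\<close>).
\<close>

section \<open>Words and the permutations that they represent\<close>

lemma word_perm_Nil [simp]: "word_perm [] = id"
  by (simp add: word_perm_def)

lemma word_perm_Cons [simp]:
  "word_perm (a # as) = Transposition.transpose a (Suc a) \<circ> word_perm as"
  by (simp add: word_perm_def)

lemma word_perm_append [simp]: "word_perm (as @ bs) = word_perm as \<circ> word_perm bs"
  by (induction as) (simp_all add: comp_assoc)

lemma transpose_permutes_symgrp:
  assumes "a \<in> {1..<n}"
  shows "Transposition.transpose a (Suc a) permutes {1..n}"
  using assms by (intro permutes_swap_id) auto

lemma word_perm_permutes:
  assumes "set as \<subseteq> {1..<n}"
  shows "word_perm as permutes {1..n}"
  using assms
proof (induction as)
  case Nil
  then show ?case using permutes_id[of "{1..n}"] by (simp add: id_def)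
next
  case (Cons a as)
  then have "word_perm as permutes {1..n}" "Transposition.transpose a (Suc a) permutes {1..n}"
    using transpose_permutes_symgrp[of a n] by auto
  then show ?case unfolding word_perm_Cons by (rule permutes_compose)
qed

lemma word_perm_in_symgrp: "set as \<subseteq> {1..<n} \<Longrightarrow> word_perm as \<in> symgrp n"
  unfolding symgrp_def by (rule CollectI, rule word_perm_permutes)

lemma inv_word_perm: "Hilbert_Choice.inv (word_perm as) = word_perm (rev as)"
proof -
  have "word_perm (rev as) \<circ> word_perm as = id" for as
  proof (induction as)
    case (Cons a as)
    have "word_perm (rev (a # as)) \<circ> word_perm (a # as) =
       word_perm (rev as) \<circ> (Transposition.transpose a (Suc a) \<circ> Transposition.transpose a (Suc a))
         \<circ> word_perm as"
      by (simp only: word_perm_append word_perm_Cons word_perm_Nil rev.simps comp_assoc o_id comp_id)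
    also have "\<dots> = id" using Cons by (simp only: transpose_comp_involutory o_id comp_id)
    finally show ?case .
  qed simp
  from this[of as] this[of "rev as"] show ?thesis
    by (intro inv_unique_comp) simp_all
qed

lemma word_perm_bij: "bij (word_perm as)"
proof (induction as)
  case (Cons a as)
  then show ?case unfolding word_perm_Cons by (intro bij_comp) simp_all
qed (simp only: word_perm_Nil bij_id)

text \<open>These are the words of the factors \<open>(1 + tu\<^bsub>n-1\<^esub>) \<dots> (1 + tu\<^bsub>k\<^esub>)\<close> of a Schubert polynomial, and
  also the coset representatives of \<open>S\<^bsub>n-1\<^esub>\<close> in \<open>S\<^sub>n\<close>: every permutation is one of \<open>S\<^bsub>n-1\<^esub>\<close>
  followed on the right by the cycle of such a word.\<close>

definition desc_word :: "nat \<Rightarrow> nat \<Rightarrow> nat list" where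
  "desc_word k n = rev [k..<n]"

lemma set_desc_word [simp]: "set (desc_word k n) = {k..<n}"
  by (simp add: desc_word_def)

lemma desc_word_empty [simp]: "n \<le> k \<Longrightarrow> desc_word k n = []"
  by (simp add: desc_word_def)

lemma desc_word_Suc: "k \<le> n \<Longrightarrow> desc_word k (Suc n) = n # desc_word k n"
  by (simp add: desc_word_def)

lemma desc_word_snoc: "k < n \<Longrightarrow> desc_word k n = desc_word (Suc k) n @ [k]"
  by (simp add: desc_word_def upt_conv_Cons)

lemma desc_word_append: "k \<le> l \<Longrightarrow> l \<le> n \<Longrightarrow> desc_word k n = desc_word l n @ desc_word k l"
  using upt_add_eq_append[of k l "n - l"] by (simp add: desc_word_def)

lemma word_perm_desc:
  assumes "k \<le> Suc m"
  shows "word_perm (desc_word k (Suc m)) =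
    (\<lambda>j. if j = k then Suc m else if k < j \<and> j \<le> Suc m then j - 1 else j)"
  using assms
proof (induction m)
  case 0
  then have "k = 0 \<or> k = 1" by auto
  then show ?case
    by (auto simp: fun_eq_iff Transposition.transpose_def desc_word_Suc)
next
  case (Suc m)
  show ?case
  proof (cases "k = Suc (Suc m)")
    case True
    then show ?thesis by (auto simp: fun_eq_iff)
  next
    case False
    then have k: "k \<le> Suc m" using Suc.prems by simp
    have "desc_word k (Suc (Suc m)) = Suc m # desc_word k (Suc m)"
      using k by (simp add: desc_word_Suc)
    then show ?thesis
      using Suc.IH[OF k] k by (auto simp: fun_eq_iff Transposition.transpose_def)
  qed
qed

text \<open>If \<open>w\<close> sends \<open>k\<close> to \<open>n\<close>, then cancelling the cycle of the descending word from \<open>n - 1\<close> to \<open>k\<close>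
  on the right leaves a permutation that fixes \<open>n\<close>, and induction applies.\<close>

lemma ex_word_perm:
  assumes "w permutes {1..n}"
  shows "\<exists>as. set as \<subseteq> {1..<n} \<and> word_perm as = w"
  using assms
proof (induction n arbitrary: w)
  case 0
  then show ?case by (intro exI[of _ "[]"]) simp
next
  case (Suc m)
  define k where "k = Hilbert_Choice.inv w (Suc m)"
  have "Suc m \<in> {1..Suc m}" by simp
  then have k: "k \<in> {1..Suc m}"
    unfolding k_def using permutes_in_image[OF permutes_inv[OF Suc.prems]] by blast
  have wk: "w k = Suc m"
    unfolding k_def using permutes_inverses(1)[OF Suc.prems] .
  let ?d = "desc_word k (Suc m)"
  have d: "set ?d \<subseteq> {1..<Suc m}" using k by auto
  define e where "e = word_perm ?d"
  have e: "e permutes {1..Suc m}" unfolding e_def by (rule word_perm_permutes[OF d])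
  have ek: "e k = Suc m" using k word_perm_desc[of k m] by (simp add: e_def)
  define v where "v = w \<circ> Hilbert_Choice.inv e"
  have "v permutes {1..Suc m}"
    unfolding v_def by (rule permutes_compose[OF permutes_inv[OF e] Suc.prems])
  moreover have "v (Suc m) = Suc m"
    using permutes_inverses(2)[OF e, of k] by (simp add: v_def wk ek)
  moreover have "x = Suc m" if "x \<in> {1..Suc m} - {1..m}" for x using that by auto
  ultimately have "v permutes {1..m}" by (metis permutes_superset)
  from Suc.IH[OF this] obtain as where as: "set as \<subseteq> {1..<m}" "word_perm as = v" by blast
  have "word_perm (as @ ?d) = v \<circ> e" by (simp only: word_perm_append as(2) e_def)
  also have "\<dots> = w" using permutes_inv_o(2)[OF e] by (simp add: v_def comp_assoc)
  finally have "word_perm (as @ ?d) = w" .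
  moreover have "set (as @ ?d) \<subseteq> {1..<Suc m}" using as(1) d by auto
  ultimately show ?case by blast
qed

lemma perm_length_le: "set as \<subseteq> {1..<n} \<Longrightarrow> perm_length n (word_perm as) \<le> length as"
  unfolding perm_length_def by (rule Least_le) blast

lemma ex_reduced_word:
  assumes "w \<in> symgrp n"
  shows "\<exists>as. reduced_word n w as"
proof -
  obtain as where "set as \<subseteq> {1..<n}" "word_perm as = w"
    using ex_word_perm assms unfolding symgrp_def by blast
  then have "\<exists>as'. set as' \<subseteq> {1..<n} \<and> word_perm as' = w \<and> length as' = perm_length n w"
    unfolding perm_length_def
    by (intro LeastI[of "\<lambda>l. \<exists>as. set as \<subseteq> {1..<n} \<and> word_perm as = w \<and> length as = l" "length as"])
      blast
  then show ?thesis unfolding reduced_word_def .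
qed

lemma perm_length_comp_le:
  assumes "u \<in> symgrp n" "v \<in> symgrp n"
  shows "perm_length n (u \<circ> v) \<le> perm_length n u + perm_length n v"
proof -
  obtain as bs where "reduced_word n u as" "reduced_word n v bs"
    using assms[THEN ex_reduced_word] by blast
  then show ?thesis
    using perm_length_le[of "as @ bs" n] unfolding reduced_word_def by auto
qed

text \<open>Cutting a reduced word in two is the same as choosing a reduced factorization together with a
  reduced word of each factor: a word that is too long on one side of the cut is too long as a whole.\<close>

lemma reduced_word_append_iff:
  "reduced_word n w (as @ bs) \<longleftrightarrow>
     (\<exists>u v. (u, v) \<in> reduced_factorizations n w \<and> reduced_word n u as \<and> reduced_word n v bs)"
proof
  assume red: "reduced_word n w (as @ bs)"
  let ?u = "word_perm as" and ?v = "word_perm bs"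
  have s: "set as \<subseteq> {1..<n}" "set bs \<subseteq> {1..<n}" and w: "w = ?u \<circ> ?v"
    and l: "length as + length bs = perm_length n w"
    using red unfolding reduced_word_def by auto
  have uv: "?u \<in> symgrp n" "?v \<in> symgrp n" using s word_perm_in_symgrp by blast+
  have "length as = perm_length n ?u" "length bs = perm_length n ?v"
    using perm_length_comp_le[OF uv] perm_length_le[OF s(1)] perm_length_le[OF s(2)] l w by auto
  then show "\<exists>u v. (u, v) \<in> reduced_factorizations n w \<and> reduced_word n u as \<and> reduced_word n v bs"
    using s w l uv unfolding reduced_word_def reduced_factorizations_def by auto
next
  assume "\<exists>u v. (u, v) \<in> reduced_factorizations n w \<and> reduced_word n u as \<and> reduced_word n v bs"
  then show "reduced_word n w (as @ bs)"
    unfolding reduced_word_def reduced_factorizations_def by auto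
qed

lemma perm_length_inv:
  assumes "w \<in> symgrp n"
  shows "perm_length n (Hilbert_Choice.inv w) = perm_length n w"
proof -
  have *: "perm_length n (Hilbert_Choice.inv w) \<le> perm_length n w" if "w \<in> symgrp n" for w
  proof -
    obtain as where "reduced_word n w as" using ex_reduced_word[OF \<open>w \<in> symgrp n\<close>] by blast
    then show ?thesis
      using perm_length_le[of "rev as" n] unfolding reduced_word_def
      by (auto simp: inv_word_perm[symmetric])
  qed
  have "Hilbert_Choice.inv w \<in> symgrp n" "Hilbert_Choice.inv (Hilbert_Choice.inv w) = w"
    using assms permutes_inv[of w] permutes_inv_inv[of w] by (auto simp: symgrp_def)
  then show ?thesis using *[of w] *[of "Hilbert_Choice.inv w"] assms by simp
qed

lemma reduced_word_inv_iff:
  assumes "w \<in> symgrp n"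
  shows "reduced_word n (Hilbert_Choice.inv w) as \<longleftrightarrow> reduced_word n w (rev as)"
proof -
  have "word_perm as = Hilbert_Choice.inv w \<longleftrightarrow> word_perm (rev as) = w"
    using assms permutes_inv_inv[of w] inv_word_perm[of as] inv_word_perm[of "rev as"]
    by (auto simp: symgrp_def)
  then show ?thesis using perm_length_inv[OF assms] unfolding reduced_word_def by simp
qed

section \<open>Matsumoto's theorem\<close>

text \<open>The commutation and braid moves preserve the length, the set of letters and the permutation of
  a word. A word is null if moves bring two equal letters next to each other; then it vanishes in
  the nilCoxeter algebra. All other words turn out to be reduced, and moves connect any two of
  them with the same permutation.\<close>

inductive braid_eq :: "nat list \<Rightarrow> nat list \<Rightarrow> bool" (infix \<open>\<sim>\<^sub>B\<close> 50) where
  braid_refl: "as \<sim>\<^sub>B as"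
| braid_trans: "as \<sim>\<^sub>B bs \<Longrightarrow> bs \<sim>\<^sub>B cs \<Longrightarrow> as \<sim>\<^sub>B cs"
| braid_far: "i + 2 \<le> j \<or> j + 2 \<le> i \<Longrightarrow> as @ [i, j] @ bs \<sim>\<^sub>B as @ [j, i] @ bs"
| braid_up: "as @ [i, Suc i, i] @ bs \<sim>\<^sub>B as @ [Suc i, i, Suc i] @ bs"
| braid_down: "as @ [Suc i, i, Suc i] @ bs \<sim>\<^sub>B as @ [i, Suc i, i] @ bs"

lemmas [trans] = braid_trans

lemma braid_sym: "as \<sim>\<^sub>B bs \<Longrightarrow> bs \<sim>\<^sub>B as"
proof (induction rule: braid_eq.induct)
  case (braid_far i j as bs)
  then show ?case by (intro braid_eq.braid_far) auto
qed (rule braid_refl braid_up braid_down | erule (1) braid_trans[rotated])+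

lemma braid_context: "as \<sim>\<^sub>B bs \<Longrightarrow> ps @ as @ qs \<sim>\<^sub>B ps @ bs @ qs"
proof (induction rule: braid_eq.induct)
  case (braid_far i j as bs)
  then show ?case using braid_eq.braid_far[of i j "ps @ as" "bs @ qs"] by simp
next
  case (braid_up as i bs)
  then show ?case using braid_eq.braid_up[of "ps @ as" i "bs @ qs"] by simp
next
  case (braid_down as i bs)
  then show ?case using braid_eq.braid_down[of "ps @ as" i "bs @ qs"] by simp
next
  case (braid_trans as bs cs)
  then show ?case using braid_eq.braid_trans by blast
qed (rule braid_refl)

lemmas braid_prefix = braid_context[of _ _ _ "[]", simplified]
lemmas braid_suffix = braid_context[of _ _ "[]", simplified]

lemma braid_set: "as \<sim>\<^sub>B bs \<Longrightarrow> set as = set bs"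
  by (induction rule: braid_eq.induct) auto

lemma braid_length: "as \<sim>\<^sub>B bs \<Longrightarrow> length as = length bs"
  by (induction rule: braid_eq.induct) auto

lemma braid_word_perm: "as \<sim>\<^sub>B bs \<Longrightarrow> word_perm as = word_perm bs"
proof (induction rule: braid_eq.induct)
  case (braid_far i j as bs)
  then have "word_perm [i, j] = word_perm [j, i]"
    by (auto simp: fun_eq_iff Transposition.transpose_def)
  then show ?case by (simp only: word_perm_append)
next
  case (braid_up as i bs)
  have "word_perm [i, Suc i, i] = word_perm [Suc i, i, Suc i]"
    by (auto simp: fun_eq_iff Transposition.transpose_def)
  then show ?case by (simp only: word_perm_append)
next
  case (braid_down as i bs)
  have "word_perm [i, Suc i, i] = word_perm [Suc i, i, Suc i]"
    by (auto simp: fun_eq_iff Transposition.transpose_def)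
  then show ?case by (simp only: word_perm_append)
qed auto

lemma braid_move_past:
  assumes "\<forall>b\<in>set bs. b + 2 \<le> a \<or> a + 2 \<le> b"
  shows "bs @ [a] \<sim>\<^sub>B a # bs"
  using assms
proof (induction bs)
  case Nil
  then show ?case by (simp add: braid_refl)
next
  case (Cons b bs)
  then have "(b # bs) @ [a] \<sim>\<^sub>B b # a # bs"
    using braid_prefix[of "bs @ [a]" "a # bs" "[b]"] by simp
  also have "b # a # bs \<sim>\<^sub>B a # b # bs"
    using braid_far[of b a "[]" bs] Cons.prems by simp
  finally show ?case .
qed

definition null_word :: "nat list \<Rightarrow> bool" where
  "null_word as \<longleftrightarrow> (\<exists>ps i qs. as \<sim>\<^sub>B ps @ [i, i] @ qs)"

lemma null_word_braid: "as \<sim>\<^sub>B bs \<Longrightarrow> null_word bs \<Longrightarrow> null_word as"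
  unfolding null_word_def by (blast intro: braid_trans)

lemma null_word_context:
  assumes "null_word as"
  shows "null_word (ps @ as @ qs)"
proof -
  obtain xs i ys where "as \<sim>\<^sub>B xs @ [i, i] @ ys" using assms unfolding null_word_def by blast
  then have "ps @ as @ qs \<sim>\<^sub>B (ps @ xs) @ [i, i] @ (ys @ qs)"
    using braid_context[of as "xs @ [i, i] @ ys" ps qs] by simp
  then show ?thesis unfolding null_word_def by blast
qed

lemma reduced_word_not_null:
  assumes "reduced_word n w as"
  shows "\<not> null_word as"
proof
  assume "null_word as"
  then obtain ps i qs where b: "as \<sim>\<^sub>B ps @ [i, i] @ qs" unfolding null_word_def by blast
  have "word_perm as = word_perm (ps @ qs)"
    using braid_word_perm[OF b] by (simp add: comp_assoc[symmetric])
  moreover have "length as = length (ps @ qs) + 2" "set (ps @ qs) \<subseteq> {1..<n}"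
    using braid_length[OF b] braid_set[OF b] assms unfolding reduced_word_def by auto
  ultimately show False
    using perm_length_le[of "ps @ qs" n] assms unfolding reduced_word_def by simp
qed

text \<open>The letter \<open>a\<close> commutes leftwards up to the factor \<open>a, a - 1\<close> of the descending word; the braid
  move then turns \<open>a, a - 1, a\<close> into \<open>a - 1, a, a - 1\<close>, whose first letter commutes with everything
  above \<open>a\<close>.\<close>

lemma desc_word_move:
  assumes k: "k < a" and a: "a \<le> m"
  shows "desc_word k (Suc m) @ [a] \<sim>\<^sub>B (a - 1) # desc_word k (Suc m)"
proof -
  define X where "X = desc_word (Suc a) (Suc m)"
  define Y where "Y = desc_word k (a - 1)"
  have "desc_word k (Suc m) = X @ desc_word k (Suc a)"
    unfolding X_def using k a by (intro desc_word_append) auto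
  also have "desc_word k (Suc a) = [a, a - 1] @ Y"
    using k desc_word_Suc[of k a] desc_word_Suc[of k "a - 1"] by (simp add: Y_def)
  finally have d: "desc_word k (Suc m) = X @ [a, a - 1] @ Y" .
  have "desc_word k (Suc m) @ [a] = (X @ [a, a - 1]) @ (Y @ [a])" by (simp add: d)
  also have "\<dots> \<sim>\<^sub>B (X @ [a, a - 1]) @ (a # Y)"
    by (intro braid_prefix braid_move_past) (auto simp: Y_def)
  also have "(X @ [a, a - 1]) @ (a # Y) = X @ [Suc (a - 1), a - 1, Suc (a - 1)] @ Y"
    using k by simp
  also have "\<dots> \<sim>\<^sub>B X @ [a - 1, Suc (a - 1), a - 1] @ Y" by (rule braid_down)
  also have "\<dots> = (X @ [a - 1]) @ [a, a - 1] @ Y" using k by simp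
  also have "\<dots> \<sim>\<^sub>B ((a - 1) # X) @ [a, a - 1] @ Y"
    by (intro braid_suffix braid_move_past) (use k in \<open>auto simp: X_def\<close>)
  also have "\<dots> = (a - 1) # desc_word k (Suc m)" by (simp add: d)
  finally show ?thesis .
qed

text \<open>Letters are appended one at a time. The new letter commutes past the descending tail, prolongs it,
  repeats its last letter, or moves through it by the preceding lemma.\<close>

lemma word_normal_form:
  assumes "set as \<subseteq> {1..<Suc m}"
  shows "null_word as \<or>
    (\<exists>bs k. set bs \<subseteq> {1..<m} \<and> 1 \<le> k \<and> k \<le> Suc m \<and> as \<sim>\<^sub>B bs @ desc_word k (Suc m))"
  using assms
proof (induction as rule: rev_induct)
  case Nil
  then show ?case
    by (intro disjI2 exI[of _ "[]"] exI[of _ "Suc m"]) (simp add: braid_refl)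
next
  case (snoc a as)
  then consider "null_word as" | bs k where "set bs \<subseteq> {1..<m}" "1 \<le> k" "k \<le> Suc m"
    "as \<sim>\<^sub>B bs @ desc_word k (Suc m)" by auto
  then show ?case
  proof cases
    case 1
    then show ?thesis using null_word_context[of as "[]" "[a]"] by simp
  next
    case 2
    note bs = 2
    have a: "1 \<le> a" "a \<le> m" using snoc.prems by auto
    have step: "as @ [a] \<sim>\<^sub>B bs @ (desc_word k (Suc m) @ [a])"
      using braid_suffix[OF bs(4), of "[a]"] by simp
    consider "a + 1 < k" | "a + 1 = k" | "a = k" | "k < a" by linarith
    then show ?thesis
    proof cases
      case 1
      have "bs @ (desc_word k (Suc m) @ [a]) \<sim>\<^sub>B bs @ (a # desc_word k (Suc m))"
        by (intro braid_prefix braid_move_past) (use 1 in auto)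
      then have "as @ [a] \<sim>\<^sub>B (bs @ [a]) @ desc_word k (Suc m)"
        using braid_trans[OF step] by simp
      moreover have "set (bs @ [a]) \<subseteq> {1..<m}" using a 1 bs by auto
      ultimately show ?thesis using bs by blast
    next
      case 2
      then have "desc_word k (Suc m) @ [a] = desc_word a (Suc m)"
        using a desc_word_snoc[of a "Suc m"] by auto
      then show ?thesis using step bs(1) a by fastforce
    next
      case 3
      then have "desc_word k (Suc m) = desc_word (Suc a) (Suc m) @ [a]"
        using a desc_word_snoc[of a "Suc m"] by auto
      then have "as @ [a] \<sim>\<^sub>B (bs @ desc_word (Suc a) (Suc m)) @ [a, a] @ []"
        using step by simp
      then show ?thesis unfolding null_word_def by blast
    next
      case 4
      have "bs @ (desc_word k (Suc m) @ [a]) \<sim>\<^sub>B bs @ ((a - 1) # desc_word k (Suc m))"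
        by (intro braid_prefix desc_word_move 4 a)
      then have "as @ [a] \<sim>\<^sub>B (bs @ [a - 1]) @ desc_word k (Suc m)"
        using braid_trans[OF step] by simp
      moreover have "set (bs @ [a - 1]) \<subseteq> {1..<m}" using a 4 bs by auto
      ultimately show ?thesis using bs by blast
    qed
  qed
qed

text \<open>In the normal form \<open>bs @ desc_word k (Suc m)\<close> the number \<open>k\<close> is the preimage of the largest value
  under the permutation, since \<open>bs\<close> fixes that value. Equal permutations therefore have equal tails,
  which can be cancelled.\<close>

theorem matsumoto:
  assumes "set as \<subseteq> {1..<n}" "set bs \<subseteq> {1..<n}"
    and "\<not> null_word as" "\<not> null_word bs" "word_perm as = word_perm bs"
  shows "as \<sim>\<^sub>B bs"
  using assms
proof (induction n arbitrary: as bs)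
  case 0
  then show ?case by (simp add: braid_refl)
next
  case (Suc m)
  obtain as' k where as': "set as' \<subseteq> {1..<m}" "1 \<le> k" "k \<le> Suc m" "as \<sim>\<^sub>B as' @ desc_word k (Suc m)"
    using word_normal_form[OF Suc.prems(1)] Suc.prems(3) by blast
  obtain bs' l where bs': "set bs' \<subseteq> {1..<m}" "1 \<le> l" "l \<le> Suc m" "bs \<sim>\<^sub>B bs' @ desc_word l (Suc m)"
    using word_normal_form[OF Suc.prems(2)] Suc.prems(4) by blast
  have fix_top: "word_perm cs (Suc m) = Suc m" if "set cs \<subseteq> {1..<m}" for cs
    using permutes_not_in[OF word_perm_permutes[OF that]] by simp
  have perms: "word_perm (as' @ desc_word k (Suc m)) = word_perm (bs' @ desc_word l (Suc m))"
    by (rule trans[OF braid_word_perm[OF braid_sym[OF as'(4)]]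
          trans[OF Suc.prems(5) braid_word_perm[OF bs'(4)]]])
  have "word_perm (as' @ desc_word k (Suc m)) k = Suc m" "word_perm (bs' @ desc_word l (Suc m)) l = Suc m"
    using word_perm_desc[OF as'(3)] word_perm_desc[OF bs'(3)] fix_top as'(1) bs'(1) by simp_all
  then have "word_perm (bs' @ desc_word l (Suc m)) k = word_perm (bs' @ desc_word l (Suc m)) l"
    unfolding perms[symmetric] by (simp only:)
  then have kl: "k = l"
    using injD[OF bij_is_inj[OF word_perm_bij]] by blast
  have "word_perm as' = word_perm bs'"
  proof
    fix j
    obtain i where "j = word_perm (desc_word k (Suc m)) i"
      using surjD[OF bij_is_surj[OF word_perm_bij]] by blast
    then show "word_perm as' j = word_perm bs' j"
      using fun_cong[OF perms, of i] by (simp only: kl word_perm_append comp_apply)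
  qed
  moreover have "\<not> null_word as'" "\<not> null_word bs'"
    using null_word_context[of as' "[]" "desc_word k (Suc m)"] null_word_context[of bs' "[]" "desc_word l (Suc m)"]
      null_word_braid[OF as'(4)] null_word_braid[OF bs'(4)] Suc.prems(3,4) by auto
  moreover have "set as' \<subseteq> {1..<m}" "set bs' \<subseteq> {1..<m}" using as' bs' by auto
  ultimately have "as' \<sim>\<^sub>B bs'" using Suc.IH by blast
  then have "as' @ desc_word k (Suc m) \<sim>\<^sub>B bs' @ desc_word l (Suc m)"
    unfolding kl by (rule braid_suffix)
  then show ?case
    using as'(4) bs'(4) by (meson braid_trans braid_sym)
qed

section \<open>The nilCoxeter algebra as a quotient of the free algebra\<close>

text \<open>Identities that are additive in an element of the free algebra need to be checked on monomials only.\<close>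

lemma poly_mapping_induct_add [case_names single add]:
  assumes "\<And>k v. P (Poly_Mapping.single k v)"
    and "\<And>f g. P f \<Longrightarrow> P g \<Longrightarrow> P (f + g)"
  shows "P (f :: 'a \<Rightarrow>\<^sub>0 'b::comm_monoid_add)"
proof (induction f rule: update_induct)
  case const
  then show ?case using assms(1)[of undefined 0] by simp
next
  case (update f a b)
  have "Poly_Mapping.update a b f = f + Poly_Mapping.single a b"
    using update(1)
    by (intro poly_mapping_eqI)
      (auto simp: lookup_update lookup_add lookup_single when_def in_keys_iff)
  then show ?case using assms update by simp
qed

abbreviation scalar :: "'r \<Rightarrow> gen_word \<Rightarrow>\<^sub>0 'r::comm_ring_1" where
  "scalar t \<equiv> Poly_Mapping.single 0 t"

lemma word_elt_Nil: "word_elt [] = 1"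
  by (simp add: word_elt_def zero_gen_word_def[symmetric])

lemma word_elt_append: "word_elt (as @ bs) = word_elt as * word_elt bs"
  by (simp add: word_elt_def mult_single plus_gen_word_def)

lemma word_elt_Cons: "word_elt (a # as) = word_elt [a] * word_elt as"
  using word_elt_append[of "[a]" as] by simp

lemma single_eq_scalar_word: "Poly_Mapping.single a t = scalar t * word_elt (letters a)"
  by (simp add: word_elt_def mult_single)

lemma scalar_commute: "scalar t * f = f * scalar t"
  by (induction f rule: poly_mapping_induct_add)
    (simp_all add: mult_single distrib_left distrib_right mult.commute)

text \<open>The coefficient functional \<open>\<langle>\<xi>, w\<rangle>\<close>, lifted to the free algebra: every reduced word of \<open>w\<close>
  counts, since all of them become \<open>u\<^sub>w\<close>, and the other words with permutation \<open>w\<close> become zero.\<close>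

definition word_coeff :: "nat \<Rightarrow> (nat \<Rightarrow> nat) \<Rightarrow> (gen_word \<Rightarrow>\<^sub>0 'r::comm_ring_1) \<Rightarrow> 'r" where
  "word_coeff n w f =
     (\<Sum>a\<in>Poly_Mapping.keys f. if reduced_word n w (letters a) then Poly_Mapping.lookup f a else 0)"

lemma word_coeff_superset:
  assumes "finite S" "Poly_Mapping.keys f \<subseteq> S"
  shows "word_coeff n w f =
    (\<Sum>a\<in>S. if reduced_word n w (letters a) then Poly_Mapping.lookup f a else 0)"
  unfolding word_coeff_def
  by (rule sum.mono_neutral_left) (use assms in \<open>auto simp: in_keys_iff\<close>)

lemma word_coeff_add [simp]: "word_coeff n w (f + g) = word_coeff n w f + word_coeff n w g"
proof -
  let ?S = "Poly_Mapping.keys f \<union> Poly_Mapping.keys g"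
  have "word_coeff n w (f + g) = (\<Sum>a\<in>?S. if reduced_word n w (letters a)
      then Poly_Mapping.lookup (f + g) a else 0)"
    by (rule word_coeff_superset) (auto dest: subsetD[OF Poly_Mapping.keys_add])
  also have "\<dots> = word_coeff n w f + word_coeff n w g"
    unfolding word_coeff_superset[of ?S f, simplified] word_coeff_superset[of ?S g, simplified]
      sum.distrib[symmetric]
    by (rule sum.cong) (auto simp: lookup_add)
  finally show ?thesis .
qed

lemma word_coeff_single:
  "word_coeff n w (Poly_Mapping.single a t) = (if reduced_word n w (letters a) then t else 0)"
  by (cases "t = 0") (simp_all add: word_coeff_def)

lemma word_coeff_zero [simp]: "word_coeff n w 0 = 0"
  by (simp add: word_coeff_def)

lemma word_coeff_diff [simp]: "word_coeff n w (f - g) = word_coeff n w f - word_coeff n w g"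
  using word_coeff_add[of n w "f - g" g] by simp

lemma word_coeff_sum [simp]: "word_coeff n w (\<Sum>i\<in>A. f i) = (\<Sum>i\<in>A. word_coeff n w (f i))"
  by (induction A rule: infinite_finite_induct) simp_all

lemma word_coeff_scalar [simp]: "word_coeff n w (scalar t * f) = t * word_coeff n w f"
  by (induction f rule: poly_mapping_induct_add)
    (simp_all add: mult_single word_coeff_single distrib_left)

lemma word_coeff_word: "word_coeff n w (word_elt as) = (if reduced_word n w as then 1 else 0)"
  by (simp add: word_elt_def word_coeff_single)

text \<open>Elements that no coefficient functional can tell apart, even after multiplication on both sides,
  form the classes of a congruence. It contains the nilCoxeter relations because braid moves preserve
  reduced words, and calculations modulo the relations are done with it: no supports of elements
  have to be tracked.\<close>

definition nc_eq :: "nat \<Rightarrow> (gen_word \<Rightarrow>\<^sub>0 'r::comm_ring_1) \<Rightarrow> (gen_word \<Rightarrow>\<^sub>0 'r) \<Rightarrow> bool" where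
  "nc_eq n f g \<longleftrightarrow> (\<forall>p q w. word_coeff n w (p * f * q) = word_coeff n w (p * g * q))"

lemma nc_eq_refl [simp]: "nc_eq n f f"
  by (simp add: nc_eq_def)

lemma nc_eq_sym: "nc_eq n f g \<Longrightarrow> nc_eq n g f"
  by (simp add: nc_eq_def)

lemma nc_eq_trans [trans]: "nc_eq n f g \<Longrightarrow> nc_eq n g h \<Longrightarrow> nc_eq n f h"
  by (simp add: nc_eq_def)

lemma nc_eq_add: "nc_eq n f f' \<Longrightarrow> nc_eq n g g' \<Longrightarrow> nc_eq n (f + g) (f' + g')"
  by (simp add: nc_eq_def distrib_left distrib_right)

lemma nc_eq_diff: "nc_eq n f f' \<Longrightarrow> nc_eq n g g' \<Longrightarrow> nc_eq n (f - g) (f' - g')"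
  by (simp add: nc_eq_def left_diff_distrib right_diff_distrib)

lemma nc_eq_mult_left: "nc_eq n g g' \<Longrightarrow> nc_eq n (f * g) (f * g')"
  unfolding nc_eq_def by (simp add: mult.assoc[symmetric])

lemma nc_eq_mult_right: "nc_eq n f f' \<Longrightarrow> nc_eq n (f * g) (f' * g)"
  unfolding nc_eq_def by (simp add: mult.assoc)

lemma word_coeff_cong: "nc_eq n f g \<Longrightarrow> word_coeff n w f = word_coeff n w g"
  unfolding nc_eq_def by (metis mult_1_left mult_1_right)

lemma nc_eqI:
  assumes "\<And>ps qs w. word_coeff n w (word_elt ps * f * word_elt qs) =
    word_coeff n w (word_elt ps * g * word_elt qs)"
  shows "nc_eq n f g"
  unfolding nc_eq_def
proof (intro allI)
  fix p q w
  show "word_coeff n w (p * f * q) = word_coeff n w (p * g * q)"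
  proof (induction p rule: poly_mapping_induct_add)
    case (single a s)
    show ?case
    proof (induction q rule: poly_mapping_induct_add)
      case (single b t)
      have move: "x * (scalar t * y) = scalar t * (x * y)" for x y
        by (simp only: mult.assoc[symmetric] scalar_commute[of t x])
      have "Poly_Mapping.single a s * h * Poly_Mapping.single b t =
        scalar s * (scalar t * (word_elt (letters a) * h * word_elt (letters b)))" for h
        unfolding single_eq_scalar_word[of a] single_eq_scalar_word[of b]
        by (simp only: move) (simp only: mult.assoc move)
      then show ?case by (simp only: word_coeff_scalar assms)
    qed (simp add: distrib_left)
  qed (simp add: distrib_right)
qed

lemma braid_reduced_word:
  assumes "as \<sim>\<^sub>B bs"
  shows "reduced_word n w as \<longleftrightarrow> reduced_word n w bs"
  using braid_set[OF assms] braid_length[OF assms] braid_word_perm[OF assms]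
  by (simp add: reduced_word_def)

lemma nc_eq_braid:
  assumes "as \<sim>\<^sub>B bs"
  shows "nc_eq n (word_elt as) (word_elt bs)"
  by (rule nc_eqI)
    (simp add: word_elt_append[symmetric] word_coeff_word
      braid_reduced_word[OF braid_context[OF assms]])

lemma nc_eq_null:
  assumes "null_word as"
  shows "nc_eq n (word_elt as) 0"
  using reduced_word_not_null[of n] null_word_context[OF assms]
  by (intro nc_eqI) (auto simp: word_elt_append[symmetric] word_coeff_word)

lemma null_word_square: "null_word [i, i]"
  unfolding null_word_def by (intro exI[of _ "[]"] exI[of _ i]) (simp add: braid_refl)

lemma word_elt_carrier: "set as \<subseteq> {1..<n} \<Longrightarrow> word_elt as \<in> carrier (free_alg n)"
  by (auto simp: free_alg_def word_elt_def)

lemma scalar_carrier: "scalar t \<in> carrier (free_alg n)"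
  by (auto simp: free_alg_def zero_gen_word_def)

lemma free_alg_simps [simp]:
  "f \<otimes>\<^bsub>free_alg n\<^esub> g = f * g" "\<one>\<^bsub>free_alg n\<^esub> = 1"
  "f \<oplus>\<^bsub>free_alg n\<^esub> g = f + g" "\<zero>\<^bsub>free_alg n\<^esub> = 0"
  by (simp_all add: free_alg_def)

lemma free_alg_uminus:
  assumes "f \<in> carrier (free_alg n)"
  shows "\<ominus>\<^bsub>free_alg n\<^esub> f = - f"
proof -
  interpret R: ring "free_alg n" by (rule ring_free_alg)
  have "- f \<in> carrier (free_alg n)" using assms by (simp add: free_alg_def Poly_Mapping.in_keys_iff)
  then show ?thesis using R.minus_equality[of "- f" f] assms by simp
qed

lemma free_alg_minus:
  assumes "f \<in> carrier (free_alg n)" "g \<in> carrier (free_alg n)"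
  shows "f \<ominus>\<^bsub>free_alg n\<^esub> g = f - g"
  using assms by (simp add: a_minus_def free_alg_uminus)

lemma free_alg_closed:
  assumes "f \<in> carrier (free_alg n)" "g \<in> carrier (free_alg n)"
  shows "f + g \<in> carrier (free_alg n)" "f * g \<in> carrier (free_alg n)"
    "f - g \<in> carrier (free_alg n)"
proof -
  interpret R: ring "free_alg n" by (rule ring_free_alg)
  show "f + g \<in> carrier (free_alg n)" "f * g \<in> carrier (free_alg n)"
    "f - g \<in> carrier (free_alg n)"
    using R.add.m_closed[OF assms] R.m_closed[OF assms] R.minus_closed[OF assms]
      free_alg_minus[OF assms] by simp_all
qed

lemma free_alg_one_zero: "1 \<in> carrier (free_alg n)" "0 \<in> carrier (free_alg n)"
  by (simp_all add: free_alg_def zero_gen_word_def)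

lemma free_alg_sum_closed:
  "(\<And>v. v \<in> A \<Longrightarrow> g v \<in> carrier (free_alg n)) \<Longrightarrow> (\<Sum>v\<in>A. g v) \<in> carrier (free_alg n)"
  by (induction A rule: infinite_finite_induct) (auto simp: free_alg_one_zero free_alg_closed)

lemma nilcoxeter_rels_carrier: "nilcoxeter_rels n \<subseteq> carrier (free_alg n)"
  unfolding nilcoxeter_rels_def
  by (auto intro!: word_elt_carrier free_alg_closed)

lemma ideal_nilcoxeter: "ideal (nilcoxeter_ideal n) (free_alg n)"
  unfolding nilcoxeter_ideal_def
  by (rule ring.genideal_ideal[OF ring_free_alg nilcoxeter_rels_carrier])

lemma nilcoxeter_rels_nc_eq:
  assumes "f \<in> nilcoxeter_rels n"
  shows "nc_eq n f 0"
proof -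
  have diff: "nc_eq n (word_elt as - word_elt bs) 0" if "as \<sim>\<^sub>B bs" for as bs
    using nc_eq_diff[OF nc_eq_braid[OF that] nc_eq_refl[of n "word_elt bs"]] by simp
  consider i where "f = word_elt [i, i]"
    | i j where "f = word_elt [i, j] - word_elt [j, i]" "i + 2 \<le> j \<or> j + 2 \<le> i"
    | i where "f = word_elt [i, i + 1, i] - word_elt [i + 1, i, i + 1]"
    using assms unfolding nilcoxeter_rels_def by blast
  then show ?thesis
  proof cases
    case 1
    then show ?thesis using nc_eq_null[OF null_word_square] by simp
  next
    case 2
    then show ?thesis using diff[OF braid_far[of i j "[]" "[]"]] by simp
  next
    case 3
    then show ?thesis using diff[OF braid_up[of "[]" i "[]"]] by simp
  qed
qed

text \<open>The elements congruent to zero form an ideal that contains the relations, so the coefficient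
  functionals descend to the quotient. This is the linear independence of the basis \<open>u\<^sub>w\<close>.\<close>

lemma nilcoxeter_ideal_nc_eq:
  fixes f :: "gen_word \<Rightarrow>\<^sub>0 'r::comm_ring_1"
  assumes "f \<in> nilcoxeter_ideal n"
  shows "nc_eq n f 0"
proof -
  interpret R: ring "free_alg n :: (gen_word \<Rightarrow>\<^sub>0 'r) ring" by (rule ring_free_alg)
  let ?K = "{f :: gen_word \<Rightarrow>\<^sub>0 'r. f \<in> carrier (free_alg n) \<and> nc_eq n f 0}"
  have "ideal ?K (free_alg n)"
  proof (rule idealI[OF ring_free_alg])
    show "subgroup ?K (add_monoid (free_alg n))"
    proof (rule R.add.subgroupI)
      fix f assume f: "f \<in> ?K"
      then show "\<ominus>\<^bsub>free_alg n\<^esub> f \<in> ?K"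
        using free_alg_uminus[of f n] nc_eq_diff[of n 0 0 f 0] R.a_inv_closed[of f] by simp
    next
      fix f g assume "f \<in> ?K" "g \<in> ?K"
      then show "f \<oplus>\<^bsub>free_alg n\<^esub> g \<in> ?K"
        using nc_eq_add[of n f 0 g 0] free_alg_closed[of f n g] by simp
    qed (use free_alg_one_zero in auto)
  next
    fix f x :: "gen_word \<Rightarrow>\<^sub>0 'r"
    assume "f \<in> ?K" "x \<in> carrier (free_alg n)"
    then show "x \<otimes>\<^bsub>free_alg n\<^esub> f \<in> ?K" "f \<otimes>\<^bsub>free_alg n\<^esub> x \<in> ?K"
      using nc_eq_mult_left[of n f 0 x] nc_eq_mult_right[of n f 0 x]
        free_alg_closed[of f n x] free_alg_closed[of x n f] by simp_all
  qed
  moreover have "nilcoxeter_rels n \<subseteq> ?K"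
    using nilcoxeter_rels_nc_eq nilcoxeter_rels_carrier by blast
  ultimately show ?thesis
    using R.genideal_minimal assms unfolding nilcoxeter_ideal_def by blast
qed

lemma nilcoxeter_ideal_add:
  "f \<in> nilcoxeter_ideal n \<Longrightarrow> g \<in> nilcoxeter_ideal n \<Longrightarrow> f + g \<in> nilcoxeter_ideal n"
  using additive_subgroup.a_closed[OF ideal.axioms(1)[OF ideal_nilcoxeter], of f n g] by simp

lemma nilcoxeter_ideal_mult:
  assumes "f \<in> nilcoxeter_ideal n" "p \<in> carrier (free_alg n)" "q \<in> carrier (free_alg n)"
  shows "p * f * q \<in> nilcoxeter_ideal n"
  using ideal.I_l_closed[OF ideal_nilcoxeter assms(1,2)]
    ideal.I_r_closed[OF ideal_nilcoxeter _ assms(3), of "p * f"] by simp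

lemma nilcoxeter_ideal_uminus:
  assumes "f - g \<in> nilcoxeter_ideal n"
  shows "g - f \<in> nilcoxeter_ideal n"
proof -
  have "scalar (- 1) * (f - g) * 1 \<in> nilcoxeter_ideal n"
    by (rule nilcoxeter_ideal_mult[OF assms scalar_carrier free_alg_one_zero(1)])
  then show ?thesis by (simp add: single_uminus)
qed

lemma nilcoxeter_rels_ideal: "f \<in> nilcoxeter_rels n \<Longrightarrow> f \<in> nilcoxeter_ideal n"
  using ring.genideal_self[OF ring_free_alg nilcoxeter_rels_carrier]
  unfolding nilcoxeter_ideal_def by blast

lemma braid_nilcoxeter_ideal:
  assumes "as \<sim>\<^sub>B bs" "set as \<subseteq> {1..<n}"
  shows "word_elt as - word_elt bs \<in> nilcoxeter_ideal n"
  using assms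
proof (induction rule: braid_eq.induct)
  case (braid_refl as)
  then show ?case
    using additive_subgroup.zero_closed[OF ideal.axioms(1)[OF ideal_nilcoxeter[of n]]] by simp
next
  case (braid_trans as bs cs)
  then show ?case
    using nilcoxeter_ideal_add[of "word_elt as - word_elt bs" n "word_elt bs - word_elt cs"]
      braid_set[of as bs] by simp
next
  case (braid_far i j as bs)
  then have "word_elt [i, j] - word_elt [j, i] \<in> nilcoxeter_rels n"
    unfolding nilcoxeter_rels_def by auto
  from nilcoxeter_ideal_mult[OF nilcoxeter_rels_ideal[OF this], of "word_elt as" "word_elt bs"]
  show ?case using braid_far word_elt_carrier[of as n] word_elt_carrier[of bs n]
    by (simp only: word_elt_append right_diff_distrib left_diff_distrib mult.assoc) auto
next
  case (braid_up as i bs)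
  then have "word_elt [i, i + 1, i] - word_elt [i + 1, i, i + 1] \<in> nilcoxeter_rels n"
    unfolding nilcoxeter_rels_def by auto
  from nilcoxeter_ideal_mult[OF nilcoxeter_rels_ideal[OF this], of "word_elt as" "word_elt bs"]
  show ?case using braid_up word_elt_carrier[of as n] word_elt_carrier[of bs n]
    by (simp only: word_elt_append right_diff_distrib left_diff_distrib mult.assoc) auto
next
  case (braid_down as i bs)
  then have "word_elt [i, i + 1, i] - word_elt [i + 1, i, i + 1] \<in> nilcoxeter_rels n"
    unfolding nilcoxeter_rels_def by auto
  from nilcoxeter_ideal_mult[OF nilcoxeter_ideal_uminus[OF nilcoxeter_rels_ideal[OF this]],
      of "word_elt as" "word_elt bs"]
  show ?case using braid_down word_elt_carrier[of as n] word_elt_carrier[of bs n]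
    by (simp only: word_elt_append right_diff_distrib left_diff_distrib mult.assoc) auto
qed

lemma null_nilcoxeter_ideal:
  assumes "null_word as" "set as \<subseteq> {1..<n}"
  shows "word_elt as \<in> nilcoxeter_ideal n"
proof -
  obtain ps i qs where b: "as \<sim>\<^sub>B ps @ [i, i] @ qs" using assms(1) unfolding null_word_def by blast
  have s: "set (ps @ [i, i] @ qs) \<subseteq> {1..<n}" using assms(2) braid_set[OF b] by simp
  then have "word_elt [i, i] \<in> nilcoxeter_rels n" unfolding nilcoxeter_rels_def by auto
  from nilcoxeter_ideal_mult[OF nilcoxeter_rels_ideal[OF this], of "word_elt ps" "word_elt qs"]
  have "word_elt (ps @ [i, i] @ qs) \<in> nilcoxeter_ideal n"
    using s word_elt_carrier[of ps n] word_elt_carrier[of qs n]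
    by (simp only: word_elt_append mult.assoc) auto
  from nilcoxeter_ideal_add[OF braid_nilcoxeter_ideal[OF b assms(2)] this]
  show ?thesis by simp
qed

definition chosen_word :: "nat \<Rightarrow> (nat \<Rightarrow> nat) \<Rightarrow> nat list" where
  "chosen_word n w = (SOME as. reduced_word n w as)"

lemma chosen_word_reduced: "w \<in> symgrp n \<Longrightarrow> reduced_word n w (chosen_word n w)"
  unfolding chosen_word_def by (rule someI_ex) (rule ex_reduced_word)

lemma chosen_word_carrier: "w \<in> symgrp n \<Longrightarrow> word_elt (chosen_word n w) \<in> carrier (free_alg n)"
  using chosen_word_reduced word_elt_carrier unfolding reduced_word_def by blast

lemma finite_symgrp: "finite (symgrp n)"
  unfolding symgrp_def by (simp add: finite_permutations)

lemma reduced_word_unique: "reduced_word n v as \<Longrightarrow> reduced_word n w as \<Longrightarrow> v = w"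
  unfolding reduced_word_def by blast

definition basis_expansion :: "nat \<Rightarrow> ((nat \<Rightarrow> nat) \<Rightarrow> 'r) \<Rightarrow> gen_word \<Rightarrow>\<^sub>0 'r::comm_ring_1" where
  "basis_expansion n c = (\<Sum>v\<in>symgrp n. scalar (c v) * word_elt (chosen_word n v))"

lemma basis_expansion_carrier: "basis_expansion n c \<in> carrier (free_alg n)"
  unfolding basis_expansion_def
  by (intro free_alg_sum_closed free_alg_closed scalar_carrier chosen_word_carrier)

lemma word_coeff_basis_expansion:
  assumes "w \<in> symgrp n"
  shows "word_coeff n w (basis_expansion n c) = c w"
proof -
  have "word_coeff n w (basis_expansion n c) = (\<Sum>v\<in>symgrp n. if v = w then c v else 0)"
    unfolding basis_expansion_def word_coeff_sum
  proof (rule sum.cong[OF refl])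
    fix v assume "v \<in> symgrp n"
    then have "reduced_word n w (chosen_word n v) \<longleftrightarrow> v = w"
      using chosen_word_reduced[of v n] reduced_word_unique by blast
    then show "word_coeff n w (scalar (c v) * word_elt (chosen_word n v)) = (if v = w then c v else 0)"
      by (simp add: word_coeff_word)
  qed
  then show ?thesis using assms finite_symgrp by simp
qed

text \<open>The spanning half of the basis property: a null word lies in the ideal, and by Matsumoto's theorem
  any other word is congruent to the reduced word that is chosen for its permutation.\<close>

lemma word_minus_basis_expansion:
  assumes "set as \<subseteq> {1..<n}"
  shows "(word_elt as :: gen_word \<Rightarrow>\<^sub>0 'r::comm_ring_1) -
    basis_expansion n (\<lambda>v. word_coeff n v (word_elt as)) \<in> nilcoxeter_ideal n"
  (is "?e - _ \<in> _")
proof (cases "null_word as")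
  case True
  then have "basis_expansion n (\<lambda>v. word_coeff n v ?e) = 0"
    using reduced_word_not_null by (auto simp: basis_expansion_def word_coeff_word intro!: sum.neutral)
  then show ?thesis using null_nilcoxeter_ideal[OF True assms] by simp
next
  case False
  let ?w = "word_perm as"
  have w: "?w \<in> symgrp n" using word_perm_in_symgrp[OF assms] .
  note r = chosen_word_reduced[OF w]
  have b: "as \<sim>\<^sub>B chosen_word n ?w"
    using r False reduced_word_not_null[OF r] assms
    by (intro matsumoto[of _ n]) (auto simp: reduced_word_def)
  then have red: "reduced_word n v as \<longleftrightarrow> v = ?w" for v
    using braid_reduced_word[OF b, of n] r reduced_word_unique by blast
  have "basis_expansion n (\<lambda>v. word_coeff n v ?e) =
    (\<Sum>v\<in>symgrp n. if v = ?w then word_elt (chosen_word n v) else 0)"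
    unfolding basis_expansion_def by (intro sum.cong) (auto simp: word_coeff_word red)
  also have "\<dots> = word_elt (chosen_word n ?w)" using w finite_symgrp by simp
  finally show ?thesis using braid_nilcoxeter_ideal[OF b assms] by simp
qed

lemma minus_basis_expansion:
  assumes "f \<in> carrier (free_alg n)"
  shows "f - basis_expansion n (\<lambda>v. word_coeff n v f) \<in> nilcoxeter_ideal n"
  using assms
proof (induction f rule: update_induct)
  case const
  then show ?case
    using additive_subgroup.zero_closed[OF ideal.axioms(1)[OF ideal_nilcoxeter[of n]]]
    by (simp add: basis_expansion_def)
next
  case (update f a t)
  let ?u = "word_elt (letters a)"
  have upd: "Poly_Mapping.update a t f = f + scalar t * ?u"
    using update(1) unfolding single_eq_scalar_word[symmetric]
    by (intro poly_mapping_eqI)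
      (auto simp: lookup_update lookup_add lookup_single when_def in_keys_iff)
  have "Poly_Mapping.keys (Poly_Mapping.update a t f) = insert a (Poly_Mapping.keys f)"
    using update(1,2) by (auto simp: in_keys_iff lookup_update split: if_splits)
  then have c: "f \<in> carrier (free_alg n)" "set (letters a) \<subseteq> {1..<n}"
    using update.prems by (auto simp: free_alg_def)
  have "basis_expansion n (\<lambda>v. word_coeff n v (f + scalar t * ?u)) =
    basis_expansion n (\<lambda>v. word_coeff n v f) + scalar t * basis_expansion n (\<lambda>v. word_coeff n v ?u)"
    unfolding basis_expansion_def word_coeff_add word_coeff_scalar
    by (simp add: single_add distrib_right sum.distrib sum_distrib_left mult.assoc[symmetric] mult_single)
  then have "Poly_Mapping.update a t f - basis_expansion n (\<lambda>v. word_coeff n v (Poly_Mapping.update a t f))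
    = (f - basis_expansion n (\<lambda>v. word_coeff n v f)) +
      scalar t * (?u - basis_expansion n (\<lambda>v. word_coeff n v ?u)) * 1"
    unfolding upd by (simp add: algebra_simps)
  then show ?case
    using nilcoxeter_ideal_add[OF update(3)[OF c(1)]
        nilcoxeter_ideal_mult[OF word_minus_basis_expansion[OF c(2)] scalar_carrier[of t]
          free_alg_one_zero(1)]] by simp
qed

lemma nc_class_ring_hom: "nc_class n \<in> Ring.ring_hom (free_alg n) (nilcoxeter n)"
  unfolding nc_class_def nilcoxeter_def by (rule ideal.rcos_ring_hom[OF ideal_nilcoxeter])

lemma ring_nilcoxeter: "ring (nilcoxeter n)"
  unfolding nilcoxeter_def by (rule ideal.quotient_is_ring[OF ideal_nilcoxeter])

lemma nc_class_hom:
  assumes "f \<in> carrier (free_alg n)" "g \<in> carrier (free_alg n)"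
  shows "nc_class n f \<otimes>\<^bsub>nilcoxeter n\<^esub> nc_class n g = nc_class n (f * g)"
    "nc_class n f \<oplus>\<^bsub>nilcoxeter n\<^esub> nc_class n g = nc_class n (f + g)"
  using ring_hom_mult[OF nc_class_ring_hom assms] ring_hom_add[OF nc_class_ring_hom assms] by simp_all

lemma nc_class_one: "\<one>\<^bsub>nilcoxeter n\<^esub> = nc_class n 1"
  by (rule ring_hom_one[OF nc_class_ring_hom, symmetric, unfolded free_alg_simps])

lemma nc_class_closed: "f \<in> carrier (free_alg n) \<Longrightarrow> nc_class n f \<in> carrier (nilcoxeter n)"
  by (rule ring_hom_closed[OF nc_class_ring_hom])

lemma nc_class_eq_iff:
  assumes "f \<in> carrier (free_alg n)" "g \<in> carrier (free_alg n)"
  shows "nc_class n f = nc_class n g \<longleftrightarrow> f - g \<in> nilcoxeter_ideal n"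
  using ring.quotient_eq_iff_same_a_r_cos[OF ring_free_alg ideal_nilcoxeter assms]
    free_alg_minus[OF assms] unfolding nc_class_def by simp

lemma nc_class_sum:
  fixes g :: "'v \<Rightarrow> gen_word \<Rightarrow>\<^sub>0 'r::comm_ring_1"
  assumes "finite A" "\<And>v. v \<in> A \<Longrightarrow> g v \<in> carrier (free_alg n)"
  shows "(\<Oplus>\<^bsub>nilcoxeter n\<^esub> v \<in> A. nc_class n (g v)) = nc_class n (\<Sum>v\<in>A. g v)"
proof -
  interpret Q: ring "nilcoxeter n :: (gen_word \<Rightarrow>\<^sub>0 'r) set ring" by (rule ring_nilcoxeter)
  interpret h: RingHom.ring_hom_ring "free_alg n :: (gen_word \<Rightarrow>\<^sub>0 'r) ring" "nilcoxeter n" "nc_class n"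
    by (rule ring_hom_ringI2[OF ring_free_alg ring_nilcoxeter nc_class_ring_hom])
  show ?thesis
    using assms
  proof (induction A rule: finite_induct)
    case empty
    then show ?case using h.hom_zero by (simp only: free_alg_simps sum.empty Q.finsum_empty)
  next
    case (insert x F)
    then show ?case
      by (subst Q.finsum_insert) (auto intro!: nc_class_closed simp: nc_class_hom free_alg_sum_closed)
  qed
qed

lemma prod_list_carrier:
  "(\<And>f. f \<in> set fs \<Longrightarrow> f \<in> carrier (free_alg n)) \<Longrightarrow> prod_list fs \<in> carrier (free_alg n)"
  by (induction fs) (auto simp: free_alg_one_zero free_alg_closed)

lemma nc_prod_class:
  assumes "\<And>i. i \<in> set is \<Longrightarrow> f i \<in> carrier (free_alg n)"
  shows "nc_prod n (map (\<lambda>i. nc_class n (f i)) is) = nc_class n (prod_list (map f is))"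
  using assms
proof (induction "is")
  case Nil
  then show ?case by (simp add: nc_prod_def nc_class_one)
next
  case (Cons i "is")
  then have "prod_list (map f is) \<in> carrier (free_alg n)" by (intro prod_list_carrier) auto
  then show ?case using Cons by (simp add: nc_prod_def nc_class_hom)
qed

lemma prod_list_word_elt: "prod_list (map (\<lambda>i. word_elt [i]) as) = word_elt as"
  by (induction as) (simp_all add: word_elt_Nil word_elt_Cons[of _ "_ # _"] flip: word_elt_append)

lemma nc_basis_class:
  assumes "w \<in> symgrp n"
  shows "nc_basis n w = nc_class n (word_elt (chosen_word n w))"
proof -
  have "nc_basis n w = nc_prod n (map (\<lambda>i. nc_class n (word_elt [i])) (chosen_word n w))"
    by (simp add: nc_basis_def nc_gen_def chosen_word_def cong: map_cong)
  also have "\<dots> = nc_class n (prod_list (map (\<lambda>i. word_elt [i]) (chosen_word n w)))"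
    using chosen_word_reduced[OF assms]
    by (intro nc_prod_class word_elt_carrier) (auto simp: reduced_word_def)
  finally show ?thesis by (simp only: prod_list_word_elt)
qed

lemma finsum_nc_basis:
  "(\<Oplus>\<^bsub>nilcoxeter n\<^esub> v \<in> symgrp n. nc_smult n (c v) (nc_basis n v)) = nc_class n (basis_expansion n c)"
proof -
  interpret Q: ring "nilcoxeter n" by (rule ring_nilcoxeter)
  have "(\<Oplus>\<^bsub>nilcoxeter n\<^esub> v \<in> symgrp n. nc_smult n (c v) (nc_basis n v)) =
    (\<Oplus>\<^bsub>nilcoxeter n\<^esub> v \<in> symgrp n. nc_class n (scalar (c v) * word_elt (chosen_word n v)))"
    by (intro Q.finsum_cong')
      (auto simp: nc_smult_def nc_basis_class nc_class_hom scalar_carrier chosen_word_carrier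
        intro!: nc_class_closed free_alg_closed)
  then show ?thesis
    unfolding basis_expansion_def
    by (subst (asm) nc_class_sum) (auto simp: finite_symgrp intro!: free_alg_closed scalar_carrier chosen_word_carrier)
qed

text \<open>With both halves of the basis property, the description of a coefficient by a unique choice
  reduces to the functional on the free algebra.\<close>

theorem nc_coeff_class:
  assumes f: "f \<in> carrier (free_alg n)" and w: "w \<in> symgrp n"
  shows "nc_coeff n (nc_class n f) w = word_coeff n w f"
  unfolding nc_coeff_def finsum_nc_basis nc_class_eq_iff[OF f basis_expansion_carrier]
proof (rule the_equality)
  show "\<exists>c. c w = word_coeff n w f \<and> f - basis_expansion n c \<in> nilcoxeter_ideal n"
    by (intro exI[of _ "\<lambda>v. word_coeff n v f"] conjI refl minus_basis_expansion f)
next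
  fix r assume "\<exists>c. c w = r \<and> f - basis_expansion n c \<in> nilcoxeter_ideal n"
  then obtain c where c: "c w = r" "f - basis_expansion n c \<in> nilcoxeter_ideal n" by blast
  from word_coeff_cong[OF nilcoxeter_ideal_nc_eq[OF c(2)], of w]
  have "word_coeff n w f = word_coeff n w (basis_expansion n c)" by simp
  then show "r = word_coeff n w f" using word_coeff_basis_expansion[OF w] c(1) by metis
qed

section \<open>Schubert polynomials in the free algebra\<close>

definition factor :: "'r \<Rightarrow> nat \<Rightarrow> gen_word \<Rightarrow>\<^sub>0 'r::comm_ring_1" where
  "factor t j = 1 + scalar t * word_elt [j]"

definition factors :: "'r \<Rightarrow> nat list \<Rightarrow> gen_word \<Rightarrow>\<^sub>0 'r::comm_ring_1" where
  "factors t js = prod_list (map (factor t) js)"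

definition schubert_elt :: "nat \<Rightarrow> (nat \<Rightarrow> 'r) \<Rightarrow> gen_word \<Rightarrow>\<^sub>0 'r::comm_ring_1" where
  "schubert_elt n x = prod_list (map (\<lambda>i. factors (x i) (desc_word i n)) [1..<n])"

lemma factor_carrier: "j \<in> {1..<n} \<Longrightarrow> factor t j \<in> carrier (free_alg n)"
  unfolding factor_def
  by (intro free_alg_closed free_alg_one_zero scalar_carrier word_elt_carrier) auto

lemma factors_carrier: "set js \<subseteq> {1..<n} \<Longrightarrow> factors t js \<in> carrier (free_alg n)"
  unfolding factors_def by (rule prod_list_carrier) (auto intro!: factor_carrier)

lemma schubert_elt_carrier: "schubert_elt n x \<in> carrier (free_alg n)"
  unfolding schubert_elt_def by (rule prod_list_carrier) (auto intro!: factors_carrier)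

theorem schubert_eq_word_coeff:
  assumes "w \<in> symgrp n"
  shows "schubert n w x = word_coeff n w (schubert_elt n x)"
proof -
  have A: "nc_A n i t = nc_class n (factors t (desc_word i n))" if "i \<in> {1..<n}" for i t
  proof -
    have "nc_A n i t = nc_prod n (map (\<lambda>j. nc_class n (factor t j)) (rev [i..<n]))"
      unfolding nc_A_def factor_def
      by (rule arg_cong[of _ _ "nc_prod n"], rule map_cong)
        (use that in \<open>auto simp: nc_smult_def nc_gen_def nc_class_one nc_class_hom scalar_carrier
          word_elt_carrier free_alg_one_zero free_alg_closed\<close>)
    also have "\<dots> = nc_class n (factors t (desc_word i n))"
      unfolding factors_def desc_word_def by (intro nc_prod_class factor_carrier) (use that in auto)
    finally show ?thesis .
  qed
  have "nc_prod n (map (\<lambda>i. nc_A n i (x i)) [1..<n]) =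
    nc_prod n (map (\<lambda>i. nc_class n (factors (x i) (desc_word i n))) [1..<n])"
    by (rule arg_cong[of _ _ "nc_prod n"], rule map_cong) (auto simp: A)
  also have "\<dots> = nc_class n (schubert_elt n x)"
    unfolding schubert_elt_def by (intro nc_prod_class factors_carrier) auto
  finally show ?thesis
    unfolding schubert_def
    using nc_coeff_class[OF schubert_elt_carrier assms] by (simp only:)
qed

section \<open>Products and reversal of words\<close>

lemma finite_reduced_factorizations: "finite (reduced_factorizations n w)"
  by (rule finite_subset[of _ "symgrp n \<times> symgrp n"])
    (auto simp: reduced_factorizations_def finite_symgrp)

text \<open>A product of two monomials is a concatenation of words, so this is the correspondence between
  the cuts of reduced words and the reduced factorizations, extended bilinearly.\<close>

lemma word_coeff_mult:
  "word_coeff n w (f * g) =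
    (\<Sum>(u, v)\<in>reduced_factorizations n w. word_coeff n u f * word_coeff n v g)"
proof (induction f rule: poly_mapping_induct_add)
  case (single a s)
  show ?case
  proof (induction g rule: poly_mapping_induct_add)
    case (single b t)
    let ?F = "reduced_factorizations n w"
    let ?r = "\<lambda>u v. reduced_word n u (letters a) \<and> reduced_word n v (letters b)"
    have "(\<Sum>(u, v)\<in>?F. word_coeff n u (Poly_Mapping.single a s) * word_coeff n v (Poly_Mapping.single b t)) =
      (\<Sum>(u, v)\<in>?F. if ?r u v then s * t else 0)"
      by (intro sum.cong) (auto simp: word_coeff_single)
    also have "\<dots> = (if reduced_word n w (letters a @ letters b) then s * t else 0)"
    proof (cases "reduced_word n w (letters a @ letters b)")
      case True
      then obtain u v where uv: "(u, v) \<in> ?F" "?r u v"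
        unfolding reduced_word_append_iff by blast
      then have unique: "u' = u \<and> v' = v" if "?r u' v'" for u' v'
        using reduced_word_unique[of n u' "letters a" u] reduced_word_unique[of n v' "letters b" v]
          that uv(2) by simp
      have zero: "(case x of (u', v') \<Rightarrow> if ?r u' v' then s * t else 0) = 0"
        if x: "x \<in> ?F - {(u, v)}" for x
      proof -
        obtain u' v' where x': "x = (u', v')" by (cases x)
        have "\<not> ?r u' v'" using unique[of u' v'] x x' by blast
        then show ?thesis unfolding x' by (simp only: prod.case if_False)
      qed
      have "(\<Sum>(u, v)\<in>?F. if ?r u v then s * t else 0) =
        (\<Sum>(u, v)\<in>{(u, v)}. if ?r u v then s * t else 0)"
        by (rule sum.mono_neutral_right[OF finite_reduced_factorizations _ ballI[OF zero]])
          (simp_all add: uv(1))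
      then show ?thesis using True uv by simp
    next
      case False
      then show ?thesis
        unfolding reduced_word_append_iff by (auto intro!: sum.neutral)
    qed
    finally show ?case
      by (simp add: mult_single word_coeff_single plus_gen_word_def)
  next
    case (add f g)
    then show ?case by (simp add: distrib_left sum.distrib split_def)
  qed
next
  case (add f g)
  then show ?case by (simp add: distrib_right sum.distrib split_def)
qed

text \<open>The anti-automorphism that fixes the generators. It moves \<open>u\<^sub>w\<close> to the basis element of the
  inverse of \<open>w\<close>, which accounts for the inverse in the definition of the reverse double
  Schubert polynomial.\<close>

definition reverse_elt :: "(gen_word \<Rightarrow>\<^sub>0 'r) \<Rightarrow> gen_word \<Rightarrow>\<^sub>0 'r::comm_ring_1" where
  "reverse_elt f = Poly_Mapping.map_key (\<lambda>a. Word (rev (letters a))) f"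

lemma inj_reverse_word: "inj (\<lambda>a. Word (rev (letters a)))"
  by (rule injI) (simp add: gen_word.expand)

lemma reverse_elt_add: "reverse_elt (f + g) = reverse_elt f + reverse_elt g"
  unfolding reverse_elt_def by (rule map_key_plus[OF inj_reverse_word])

lemma reverse_elt_single:
  "reverse_elt (Poly_Mapping.single a t) = Poly_Mapping.single (Word (rev (letters a))) t"
  using map_key_single[OF inj_reverse_word, of "Word (rev (letters a))" t]
  by (simp add: reverse_elt_def)

lemma reverse_elt_mult: "reverse_elt (f * g) = reverse_elt g * reverse_elt f"
proof (induction f rule: poly_mapping_induct_add)
  case (single a s)
  show ?case
    by (induction g rule: poly_mapping_induct_add)
      (simp_all add: mult_single reverse_elt_single plus_gen_word_def mult.commute
        distrib_left distrib_right reverse_elt_add)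
qed (simp add: distrib_left distrib_right reverse_elt_add)

lemma reverse_elt_one: "reverse_elt 1 = 1"
proof -
  have "reverse_elt (scalar 1) = scalar 1"
    unfolding reverse_elt_single by (simp add: zero_gen_word_def)
  then show ?thesis by simp
qed

lemma reverse_elt_prod_list:
  "reverse_elt (prod_list fs) = prod_list (rev (map reverse_elt fs))"
  by (induction fs) (simp_all add: reverse_elt_one reverse_elt_mult)

lemma word_coeff_inv:
  assumes "w \<in> symgrp n"
  shows "word_coeff n (Hilbert_Choice.inv w) f = word_coeff n w (reverse_elt f)"
  by (induction f rule: poly_mapping_induct_add)
    (simp_all add: word_coeff_single reverse_elt_single reverse_elt_add reduced_word_inv_iff[OF assms])

lemma factor_single: "factor t j = 1 + Poly_Mapping.single (Word [j]) t"
  by (simp add: factor_def word_elt_def mult_single)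

lemma reverse_elt_factor: "reverse_elt (factor t j) = factor t j"
  by (simp add: factor_single reverse_elt_add reverse_elt_one reverse_elt_single)

lemma reverse_elt_factors: "reverse_elt (factors t js) = factors t (rev js)"
  unfolding factors_def reverse_elt_prod_list
  by (simp add: reverse_elt_factor comp_def rev_map)

text \<open>For \<open>m = n - 1\<close> this is the reversal of the generating product of Schubert polynomials. The partial
  products are the stages of the later induction.\<close>

primrec dual_elt :: "nat \<Rightarrow> (nat \<Rightarrow> 'r) \<Rightarrow> nat \<Rightarrow> gen_word \<Rightarrow>\<^sub>0 'r::comm_ring_1" where
  "dual_elt n z 0 = 1"
| "dual_elt n z (Suc m) = factors (z (Suc m)) [Suc m..<n] * dual_elt n z m"

lemma reverse_schubert_elt: "reverse_elt (schubert_elt n z) = dual_elt n z (n - 1)"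
proof -
  have "prod_list (rev (map (\<lambda>i. factors (z i) [i..<n]) [1..<Suc m])) = dual_elt n z m" for m
    by (induction m) simp_all
  from this[of "n - 1"] show ?thesis
    by (cases n) (simp_all add: schubert_elt_def reverse_elt_prod_list comp_def reverse_elt_factors
      desc_word_def reverse_elt_one del: upt_Suc)
qed

text \<open>The sum over reduced factorizations is the coefficient of a single product.\<close>

theorem rev_double_schubert_eq:
  "rev_double_schubert n w y z =
     word_coeff n w (schubert_elt n y * dual_elt n (\<lambda>i. - z i) (n - 1))"
proof -
  have "schubert n u y * schubert n (Hilbert_Choice.inv v) (\<lambda>i. - z i) =
    word_coeff n u (schubert_elt n y) * word_coeff n v (dual_elt n (\<lambda>i. - z i) (n - 1))"
    if "(u, v) \<in> reduced_factorizations n w" for u v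
  proof -
    have uv: "u \<in> symgrp n" "v \<in> symgrp n" using that by (auto simp: reduced_factorizations_def)
    then have "Hilbert_Choice.inv v \<in> symgrp n" by (auto simp: symgrp_def intro: permutes_inv)
    then show ?thesis
      using uv by (simp add: schubert_eq_word_coeff word_coeff_inv reverse_schubert_elt)
  qed
  then show ?thesis
    unfolding rev_double_schubert_def word_coeff_mult by (intro sum.cong refl) (simp add: split_def)
qed

section \<open>The Yang-Baxter equation and its consequences\<close>

lemma eq_nc_eq_trans [trans]: "f = g \<Longrightarrow> nc_eq n g h \<Longrightarrow> nc_eq n f h"
  and nc_eq_eq_trans [trans]: "nc_eq n f g \<Longrightarrow> g = h \<Longrightarrow> nc_eq n f h"
  by simp_all

lemma nc_eq_context: "nc_eq n f g \<Longrightarrow> nc_eq n (p * f * q) (p * g * q)"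
  by (intro nc_eq_mult_left nc_eq_mult_right)

abbreviation mon :: "'r \<Rightarrow> nat list \<Rightarrow> gen_word \<Rightarrow>\<^sub>0 'r::comm_ring_1" where
  "mon t as \<equiv> Poly_Mapping.single (Word as) t"

lemma mon_scalar: "mon t as = scalar t * word_elt as"
  by (simp add: word_elt_def mult_single)

lemma mon_mult: "mon s as * mon t bs = mon (s * t) (as @ bs)"
  by (simp add: mult_single plus_gen_word_def)

lemma mon_braid: "as \<sim>\<^sub>B bs \<Longrightarrow> nc_eq n (mon t as) (mon t bs)"
  unfolding mon_scalar by (intro nc_eq_mult_left nc_eq_braid)

lemma mon_square: "nc_eq n (mon t [i, i]) 0"
  using nc_eq_mult_left[OF nc_eq_null[OF null_word_square], of n "scalar t"]
  by (simp add: mon_scalar)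

lemma factor_far_commute:
  assumes "i + 2 \<le> j \<or> j + 2 \<le> i"
  shows "nc_eq n (factor s i * factor t j) (factor t j * factor s i)"
proof -
  have "nc_eq n (mon (s * t) [i, j]) (mon (s * t) [j, i])"
    using mon_braid[OF braid_far[OF assms, of "[]" "[]"]] by simp
  from nc_eq_add[OF nc_eq_refl[of n "1 + mon s [i] + mon t [j]"] this]
  show ?thesis
    by (simp add: factor_single distrib_left distrib_right mon_mult mult.commute ac_simps)
qed

lemma factor_same: "nc_eq n (factor s i * factor t i) (factor (s + t) i)"
  using nc_eq_add[OF nc_eq_refl[of n "factor (s + t) i"] mon_square[where t = "s * t"]]
  by (simp add: factor_single distrib_left distrib_right mon_mult single_add ac_simps)

lemma factor_zero [simp]: "factor 0 i = 1"
  by (simp add: factor_def)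

text \<open>Both sides have the same terms except for those of \<open>u\<^sub>iu\<^sub>i\<close> and \<open>u\<^bsub>i+1\<^esub>u\<^bsub>i+1\<^esub>\<close>, which vanish, and those of the
  two sides of the braid relation.\<close>

lemma factor_yang_baxter:
  "nc_eq n (factor a i * factor b (Suc i) * factor (b - a) i)
     (factor (b - a) (Suc i) * factor b i * factor a (Suc i))"
proof -
  let ?j = "Suc i"
  let ?C = "1 + mon b [i] + mon b [?j] + mon (a * b) [i, ?j] + mon (b * (b - a)) [?j, i]"
  have b: "mon b [k] = mon a [k] + mon (b - a) [k]" for k
    by (simp add: single_add[symmetric])
  have "factor a i * factor b ?j * factor (b - a) i =
    ?C + mon (a * (b - a)) [i, i] + mon (a * b * (b - a)) [i, ?j, i]"
    unfolding b[of i] by (simp add: factor_single distrib_left distrib_right mon_mult ac_simps)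
  also have "nc_eq n \<dots> (?C + mon (a * (b - a)) [?j, ?j] + mon (a * b * (b - a)) [?j, i, ?j])"
    using mon_braid[OF braid_up[of "[]" i "[]"]]
    by (intro nc_eq_add nc_eq_refl nc_eq_trans[OF mon_square nc_eq_sym[OF mon_square]]) simp
  also have "\<dots> = factor (b - a) ?j * factor b i * factor a ?j"
    unfolding b[of ?j] by (simp add: factor_single distrib_left distrib_right mon_mult ac_simps)
  finally show ?thesis .
qed

lemma factors_Nil [simp]: "factors t [] = 1"
  by (simp add: factors_def)

lemma factors_Cons: "factors t (j # js) = factor t j * factors t js"
  by (simp add: factors_def)

lemma factors_append: "factors t (is @ js) = factors t is * factors t js"
  by (simp add: factors_def)

lemma factors_desc_word: "i < n \<Longrightarrow> factors t (desc_word i n) = factors t (desc_word (Suc i) n) * factor t i"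
  by (simp add: desc_word_snoc factors_append factors_Cons)

lemma factor_commute_prod:
  assumes "\<And>f. f \<in> set fs \<Longrightarrow> nc_eq n (g * f) (f * g)"
  shows "nc_eq n (g * prod_list fs) (prod_list fs * g)"
  using assms
proof (induction fs)
  case (Cons f fs)
  have "nc_eq n (g * f * prod_list fs) (f * g * prod_list fs)"
    using Cons.prems by (intro nc_eq_mult_right) simp
  also have "nc_eq n (f * g * prod_list fs) (f * (prod_list fs * g))"
    unfolding mult.assoc using Cons by (intro nc_eq_mult_left) simp
  finally show ?case by (simp add: mult.assoc)
qed simp

lemma factor_commute_factors:
  assumes "\<And>j. j \<in> set js \<Longrightarrow> i + 2 \<le> j \<or> j + 2 \<le> i"
  shows "nc_eq n (factor s i * factors t js) (factors t js * factor s i)"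
  unfolding factors_def
proof (rule factor_commute_prod)
  fix f assume "f \<in> set (map (factor t) js)"
  then obtain j where "f = factor t j" "j \<in> set js" by auto
  then show "nc_eq n (factor s i * f) (f * factor s i)"
    using factor_far_commute[OF assms] by blast
qed

lemma factor_inverse: "nc_eq n (factor a i * factor (- a) i) 1"
  using factor_same[of n a i "- a"] by simp

text \<open>The argument of Fomin and Kirillov. Write \<open>A\<^sub>i(t) = A\<^bsub>i+1\<^esub>(t)h(t)\<close> and \<open>A\<^bsub>i+1\<^esub>(t) = A\<^bsub>i+2\<^esub>(t)k(t)\<close>.
  After commuting \<open>h(a)\<close> to the right of \<open>A\<^bsub>i+2\<^esub>(b)\<close>, the Yang-Baxter equation splits off \<open>k(b)\<close>
  on the left, which restores the product \<open>A\<^bsub>i+1\<^esub>(a)A\<^bsub>i+1\<^esub>(b)\<close> to which the induction hypothesis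
  applies.\<close>

theorem factors_commute:
  fixes a b :: "'r::comm_ring_1"
  shows "nc_eq n (factors a (desc_word i n) * factors b (desc_word i n))
     (factors b (desc_word i n) * factors a (desc_word i n))"
proof (cases "i \<le> n")
  case True
  then show ?thesis
  proof (induction i rule: inc_induct)
    case base
    show ?case by simp
  next
    case (step i)
    note IH = step(3)
    show ?case
    proof (cases "Suc i = n")
      case True
      then have A: "factors t (desc_word i n) = factor t i" for t
        using factors_desc_word[of i n t] by simp
      show ?thesis
        unfolding A
        by (rule nc_eq_trans[OF factor_same[of n a i b]
              nc_eq_sym[OF factor_same[of n b i a, unfolded add.commute[of b a]]]])
    next
      case False
      let ?h = "\<lambda>t. factor t i" and ?k = "\<lambda>t. factor t (Suc i)"
      define A where "A = (\<lambda>t :: 'r. factors t (desc_word (Suc (Suc i)) n))"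
      have A: "factors t (desc_word (Suc i) n) = A t * ?k t" for t
        using False step(2) factors_desc_word[of "Suc i" n t] by (simp add: A_def)
      have Ah: "nc_eq n (?h s * A t) (A t * ?h s)" for s t
        unfolding A_def by (rule factor_commute_factors) auto
      let ?E = "?k (- a) * (?h b * ?k a * ?h a)"
      have "nc_eq n (?h a * ?k b * ?h b) (?h a * ?k b * (?h (b - a) * ?h a))"
        by (rule nc_eq_mult_left, rule nc_eq_sym) (use factor_same[of n "b - a" i a] in simp)
      also have "\<dots> = ?h a * ?k b * ?h (b - a) * ?h a" by (simp only: mult.assoc)
      also have "nc_eq n \<dots> (?k (b - a) * ?h b * ?k a * ?h a)"
        by (intro nc_eq_mult_right factor_yang_baxter)
      also have "\<dots> = ?k (b - a) * (?h b * ?k a * ?h a)" by (simp only: mult.assoc)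
      also have "nc_eq n \<dots> (?k b * ?k (- a) * (?h b * ?k a * ?h a))"
        by (rule nc_eq_mult_right, rule nc_eq_sym) (use factor_same[of n b "Suc i" "- a"] in simp)
      also have "\<dots> = ?k b * ?E" by (simp only: mult.assoc)
      finally have swap: "nc_eq n (?h a * ?k b * ?h b) (?k b * ?E)" .
      have "A a * ?k a * ?h a * (A b * ?k b * ?h b) = A a * ?k a * (?h a * A b) * (?k b * ?h b)"
        by (simp only: mult.assoc)
      also have "nc_eq n \<dots> (A a * ?k a * (A b * ?h a) * (?k b * ?h b))"
        by (rule nc_eq_context[OF Ah])
      also have "\<dots> = A a * ?k a * A b * (?h a * ?k b * ?h b)" by (simp only: mult.assoc)
      also have "nc_eq n \<dots> (A a * ?k a * A b * (?k b * ?E))"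
        by (rule nc_eq_mult_left[OF swap])
      also have "\<dots> = A a * ?k a * (A b * ?k b) * ?E" by (simp only: mult.assoc)
      also have "nc_eq n \<dots> (A b * ?k b * (A a * ?k a) * ?E)"
        by (rule nc_eq_mult_right) (use IH in \<open>simp only: A\<close>)
      also have "\<dots> = A b * ?k b * A a * (?k a * ?k (- a)) * (?h b * ?k a * ?h a)"
        by (simp only: mult.assoc)
      also have "nc_eq n \<dots> (A b * ?k b * A a * 1 * (?h b * ?k a * ?h a))"
        by (rule nc_eq_context[OF factor_inverse])
      also have "\<dots> = A b * ?k b * (A a * ?h b) * (?k a * ?h a)"
        by (simp only: mult.assoc mult_1)
      also have "nc_eq n \<dots> (A b * ?k b * (?h b * A a) * (?k a * ?h a))"
        by (rule nc_eq_context[OF nc_eq_sym[OF Ah]])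
      also have "\<dots> = A b * ?k b * ?h b * (A a * ?k a * ?h a)" by (simp only: mult.assoc)
      finally show ?thesis
        using step(2) by (simp only: factors_desc_word A)
    qed
  qed
qed (simp add: desc_word_def)

text \<open>Multiplying the commutation of \<open>A\<^sub>i(a)\<close> and \<open>A\<^sub>i(b)\<close> by \<open>1 - au\<^sub>i\<close> removes the last factor
  on one side and leaves \<open>1 + (b - a)u\<^sub>i\<close> on the other.\<close>

lemma factors_swap:
  assumes "i < n"
  shows "nc_eq n (factors a (desc_word i n) * factors b (desc_word (Suc i) n) * factor (b - a) i)
    (factors b (desc_word i n) * factors a (desc_word (Suc i) n))"
proof -
  let ?A = "\<lambda>t. factors t (desc_word i n)" and ?B = "\<lambda>t. factors t (desc_word (Suc i) n)"
  have "nc_eq n (?A a * ?B b * factor (b - a) i) (?A a * ?B b * (factor b i * factor (- a) i))"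
    by (rule nc_eq_mult_left, rule nc_eq_sym) (use factor_same[of n b i "- a"] in simp)
  also have "\<dots> = ?A a * ?A b * factor (- a) i"
    by (simp only: factors_desc_word[OF assms, of b] mult.assoc)
  also have "nc_eq n \<dots> (?A b * ?A a * factor (- a) i)"
    by (rule nc_eq_mult_right[OF factors_commute])
  also have "\<dots> = ?A b * ?B a * (factor a i * factor (- a) i)"
    by (simp only: factors_desc_word[OF assms, of a] mult.assoc)
  also have "nc_eq n \<dots> (?A b * ?B a * 1)"
    by (rule nc_eq_mult_left[OF factor_inverse])
  finally show ?thesis by simp
qed

theorem schubert_elt_swap:
  fixes y :: "nat \<Rightarrow> 'r::comm_ring_1"
  assumes k: "1 \<le> k" "k < n"
  shows "nc_eq n (schubert_elt n y * factor (y (Suc k) - y k) k)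
    (schubert_elt n (y \<circ> Transposition.transpose k (Suc k)))"
proof -
  define Q where "Q = (\<lambda>x :: nat \<Rightarrow> 'r. \<lambda>js. prod_list (map (\<lambda>i. factors (x i) (desc_word i n)) js))"
  \<comment> \<open>The empty product for the index \<open>n\<close> is added, so that the case \<open>k = n - 1\<close> is not special.\<close>
  have S: "schubert_elt n x = Q x [1..<k] * (factors (x k) (desc_word k n) *
     factors (x (Suc k)) (desc_word (Suc k) n)) * Q x [Suc (Suc k)..<Suc n]" for x
  proof -
    have "schubert_elt n x = Q x [1..<Suc n]"
      using k by (simp add: schubert_elt_def Q_def)
    also have "[1..<Suc n] = [1..<k] @ [k, Suc k] @ [Suc (Suc k)..<Suc n]"
      using k upt_add_eq_append[of 1 k "Suc n - k"] by (simp add: upt_conv_Cons del: upt_Suc)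
    finally show ?thesis by (simp add: Q_def mult.assoc del: upt_Suc)
  qed
  let ?s = "Transposition.transpose k (Suc k)" and ?f = "factor (y (Suc k) - y k) k"
  have Qs: "Q (y \<circ> ?s) js = Q y js" if "k \<notin> set js" "Suc k \<notin> set js" for js
    unfolding Q_def
    by (intro arg_cong[of _ _ prod_list] map_cong) (use that in \<open>auto simp: Transposition.transpose_def\<close>)
  have "nc_eq n (?f * Q y [Suc (Suc k)..<Suc n]) (Q y [Suc (Suc k)..<Suc n] * ?f)"
    unfolding Q_def by (rule factor_commute_prod) (auto intro!: factor_commute_factors simp del: upt_Suc)
  from nc_eq_mult_left[OF nc_eq_sym[OF this], of "Q y [1..<k] *
    (factors (y k) (desc_word k n) * factors (y (Suc k)) (desc_word (Suc k) n))"]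
  have "nc_eq n (schubert_elt n y * ?f)
    (Q y [1..<k] * (factors (y k) (desc_word k n) * factors (y (Suc k)) (desc_word (Suc k) n) * ?f) *
      Q y [Suc (Suc k)..<Suc n])"
    unfolding S by (simp only: mult.assoc)
  also have "nc_eq n \<dots> (Q y [1..<k] *
     (factors (y (Suc k)) (desc_word k n) * factors (y k) (desc_word (Suc k) n)) *
      Q y [Suc (Suc k)..<Suc n])"
    by (rule nc_eq_context[OF factors_swap[OF k(2)]])
  also have "\<dots> = schubert_elt n (y \<circ> ?s)"
    unfolding S by (simp add: Qs del: upt_Suc)
  finally show ?thesis .
qed

text \<open>Up to the factor \<open>y\<^sub>k - y\<^bsub>k+1\<^esub>\<close> this says that a generator \<open>u\<^sub>k\<close> to the right of the generating
  product of Schubert polynomials acts as the divided difference operator in \<open>y\<^sub>k\<close> and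
  \<open>y\<^bsub>k+1\<^esub>\<close>.\<close>

lemma schubert_elt_difference:
  assumes k: "1 \<le> k" "k < n"
  shows "(y k - y (Suc k)) * word_coeff n w (schubert_elt n y * (word_elt [k] * g)) =
    word_coeff n w (schubert_elt n y * g) -
    word_coeff n w (schubert_elt n (y \<circ> Transposition.transpose k (Suc k)) * g)"
proof -
  let ?d = "y (Suc k) - y k" and ?S = "schubert_elt n y"
  have "word_coeff n w (schubert_elt n (y \<circ> Transposition.transpose k (Suc k)) * g) =
    word_coeff n w (?S * factor ?d k * g)"
    by (rule word_coeff_cong[OF nc_eq_mult_right[OF nc_eq_sym[OF schubert_elt_swap[OF k]]]])
  also have "?S * factor ?d k * g = ?S * g + (?S * scalar ?d) * (word_elt [k] * g)"
    by (simp add: factor_def distrib_left distrib_right mult.assoc)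
  also have "?S * scalar ?d = scalar ?d * ?S" by (rule scalar_commute[symmetric])
  also have "word_coeff n w (?S * g + scalar ?d * ?S * (word_elt [k] * g)) =
    word_coeff n w (?S * g) + ?d * word_coeff n w (?S * (word_elt [k] * g))"
    by (simp only: word_coeff_add word_coeff_scalar mult.assoc)
  finally show ?thesis by (simp add: algebra_simps comp_def)
qed

section \<open>Complete homogeneous polynomials and determinants of power series\<close>

definition geom :: "'r \<Rightarrow> 'r::comm_ring_1 fps" where
  "geom x = Abs_fps (\<lambda>k. x ^ k)"

abbreviation lin :: "'r \<Rightarrow> 'r::comm_ring_1 fps" where
  "lin x \<equiv> 1 - fps_const x * fps_X"

lemma geom_nth [simp]: "fps_nth (geom x) k = x ^ k"
  by (simp add: geom_def)

lemma geom_lin: "geom x * lin x = 1"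
proof (rule fps_ext)
  fix k
  have "geom x * lin x = geom x - fps_const x * (fps_X * geom x)"
    by (simp add: right_diff_distrib mult.commute mult.left_commute)
  then show "fps_nth (geom x * lin x) k = fps_nth 1 k"
    by (cases k) (simp_all add: geom_def)
qed

lemma finite_exponents: "finite {e :: nat list. length e = l \<and> sum_list e = k}"
proof (rule finite_subset)
  show "{e. length e = l \<and> sum_list e = k} \<subseteq> {e. set e \<subseteq> {..k} \<and> length e = l}"
    using member_le_sum_list by auto
  show "finite {e. set e \<subseteq> {..k} \<and> length e = l}"
    by (rule finite_lists_length_eq) simp
qed

text \<open>The first exponent \<open>a\<close> is split off, which makes the sum a convolution with the geometric series
  of the first variable.\<close>

lemma complete_hom_geom:
  "complete_hom (int k) xs = fps_nth (prod_list (map geom xs)) k"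
proof (induction xs arbitrary: k)
  case Nil
  have "{e :: nat list. length e = length [] \<and> sum_list e = k} = (if k = 0 then {[]} else {})"
    by auto
  then show ?case by (simp add: complete_hom_def)
next
  case (Cons x xs)
  let ?E = "\<lambda>l k. {e :: nat list. length e = l \<and> sum_list e = k}"
  let ?P = "\<lambda>ys e. \<Prod>i<length ys. (ys ! i) ^ (e ! i)"
  have "complete_hom (int k) (x # xs) = (\<Sum>e\<in>?E (Suc (length xs)) k. ?P (x # xs) e)"
    by (simp add: complete_hom_def)
  also have "\<dots> = (\<Sum>(a, e)\<in>(SIGMA a:{0..k}. ?E (length xs) (k - a)). x ^ a * ?P xs e)"
    by (rule sum.reindex_bij_witness[of _ "\<lambda>(a, e). a # e" "\<lambda>e. (hd e, tl e)"])
      (auto simp: length_Suc_conv prod.lessThan_Suc_shift simp del: prod.lessThan_Suc)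
  also have "\<dots> = (\<Sum>a=0..k. \<Sum>e\<in>?E (length xs) (k - a). x ^ a * ?P xs e)"
    by (rule sum.Sigma[symmetric]) (auto simp: finite_exponents)
  also have "\<dots> = (\<Sum>a=0..k. x ^ a * complete_hom (int (k - a)) xs)"
    by (simp add: complete_hom_def sum_distrib_left del: of_nat_diff)
  finally show ?case by (simp only: Cons list.map prod_list.Cons fps_mult_nth geom_nth)
qed

text \<open>Row \<open>i\<close> holds the coefficients of degrees \<open>n + 1, \<dots>, 2n - 1\<close> of one power series. For
  \<open>q\<^bsup>2i\<^esup>H(q)\<close> the entry in column \<open>j\<close> is the coefficient of \<open>H\<close> of degree \<open>n - 2i + j\<close>, and zero
  if that degree is negative; the shift makes the degrees independent of the row.\<close>

definition row_det :: "nat \<Rightarrow> (nat \<Rightarrow> 'r fps) \<Rightarrow> 'r::comm_ring_1" where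
  "row_det n R =
     Determinant.det (mat (n - 1) (n - 1) (\<lambda>(a, b). fps_nth (R (Suc a)) (n + Suc b)))"

lemma row_det_cong:
  assumes "\<And>i. 1 \<le> i \<Longrightarrow> i < n \<Longrightarrow> R i = S i"
  shows "row_det n R = row_det n S"
  unfolding row_det_def
  by (intro arg_cong[of _ _ Determinant.det] cong_mat) (use assms in auto)

text \<open>Laplace expansion along row \<open>k\<close>; the cofactors do not involve that row. Only linearity in the
  row is taken from it.\<close>

lemma row_det_update:
  assumes "1 \<le> k" "k < n"
  obtains c where "\<And>F. row_det n (R(k := F)) = (\<Sum>b<n - 1. fps_nth F (n + Suc b) * c b)"
proof
  fix F
  let ?M = "\<lambda>F. mat (n - 1) (n - 1) (\<lambda>(a, b). fps_nth ((R(k := F)) (Suc a)) (n + Suc b))"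
  \<comment> \<open>The zero series stands for an arbitrary entry of the deleted row.\<close>
  have "mat_delete (?M F) (k - 1) b = mat_delete (?M 0) (k - 1) b" for b
    unfolding mat_delete_def by (rule eq_matI) (use assms in \<open>auto simp: not_less\<close>)
  then have "cofactor (?M F) (k - 1) b = cofactor (?M 0) (k - 1) b" for b
    by (simp add: cofactor_def)
  moreover have "row_det n (R(k := F)) =
    (\<Sum>b<n - 1. (?M F) $$ (k - 1, b) * cofactor (?M F) (k - 1) b)"
    unfolding row_det_def by (rule laplace_expansion_row) (use assms in auto)
  ultimately show "row_det n (R(k := F)) =
    (\<Sum>b<n - 1. fps_nth F (n + Suc b) * cofactor (?M 0) (k - 1) b)"
    using assms by simp
qed

lemma row_det_add:
  assumes "1 \<le> k" "k < n"
  shows "row_det n (R(k := F + G)) = row_det n (R(k := F)) + row_det n (R(k := G))"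
proof -
  obtain d where "\<And>F. row_det n (R(k := F)) = (\<Sum>b<n - 1. fps_nth F (n + Suc b) * d b)"
    using row_det_update[OF assms, of R] by blast
  then show ?thesis by (simp add: sum.distrib distrib_right)
qed

lemma row_det_scale:
  assumes "1 \<le> k" "k < n"
  shows "row_det n (R(k := fps_const c * F)) = c * row_det n (R(k := F))"
proof -
  obtain d where "\<And>F. row_det n (R(k := F)) = (\<Sum>b<n - 1. fps_nth F (n + Suc b) * d b)"
    using row_det_update[OF assms, of R] by blast
  then show ?thesis by (simp add: sum_distrib_left mult.assoc)
qed

text \<open>The rows of the first determinant come from those of the second by an upper unitriangular matrix.
  For the bottom row the correction would need row \<open>n\<close>, which lies outside the matrix and has
  to vanish.\<close>

lemma row_det_unitriangular:
  fixes R S :: "nat \<Rightarrow> 'r::comm_ring_1 fps"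
  assumes rows: "\<And>i. 1 \<le> i \<Longrightarrow> i < n \<Longrightarrow> R i = S i + fps_const (c i) * S (Suc i)"
    and last: "\<And>j. j < n \<Longrightarrow> fps_nth (S n) (n + j) = 0"
  shows "row_det n R = row_det n S"
proof -
  let ?N = "n - 1"
  define M where "M = mat ?N ?N (\<lambda>(a, b). fps_nth (S (Suc a)) (n + Suc b))"
  define U where
    "U = mat ?N ?N (\<lambda>(a, b). if b = a then 1 else if b = Suc a then c (Suc a) else 0)"
  have dims: "M \<in> carrier_mat ?N ?N" "U \<in> carrier_mat ?N ?N" by (auto simp: M_def U_def)
  have "mat ?N ?N (\<lambda>(a, b). fps_nth (R (Suc a)) (n + Suc b)) = U * M"
  proof (rule eq_matI)
    fix a b assume "a < dim_row (U * M)" "b < dim_col (U * M)"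
    then have ab: "a < ?N" "b < ?N" using dims by auto
    have "(U * M) $$ (a, b) =
      (\<Sum>k = 0..<?N. (if k = a then 1 else if k = Suc a then c (Suc a) else 0) *
         fps_nth (S (Suc k)) (n + Suc b))"
      using ab dims by (simp add: scalar_prod_def U_def M_def)
    also have "\<dots> = (\<Sum>k = 0..<?N. (if k = a then fps_nth (S (Suc a)) (n + Suc b) else 0) +
       (if k = Suc a then c (Suc a) * fps_nth (S (Suc (Suc a))) (n + Suc b) else 0))"
      by (rule sum.cong) auto
    also have "\<dots> = fps_nth (S (Suc a)) (n + Suc b) +
       (if Suc a < ?N then c (Suc a) * fps_nth (S (Suc (Suc a))) (n + Suc b) else 0)"
      using ab by (simp add: sum.distrib)
    also have "\<dots> = fps_nth (R (Suc a)) (n + Suc b)"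
    proof (cases "Suc a < ?N")
      case True
      then show ?thesis using rows[of "Suc a"] ab by simp
    next
      case False
      then have "Suc (Suc a) = n" using ab by simp
      then show ?thesis using rows[of "Suc a"] last[of "Suc b"] ab by simp
    qed
    finally show "mat ?N ?N (\<lambda>(a, b). fps_nth (R (Suc a)) (n + Suc b)) $$ (a, b) = (U * M) $$ (a, b)"
      using ab by simp
  qed (use dims in auto)
  moreover have "Determinant.det U = 1"
    using det_upper_triangular[OF _ dims(2)]
    by (simp add: upper_triangular_def U_def prod_list_diag_prod)
  ultimately show ?thesis
    unfolding row_det_def using det_mult[OF dims(2,1)] by (simp add: M_def)
qed

lemma fps_nth_prod_lin_eq_0:
  assumes "finite A" "card A < d"
  shows "fps_nth (\<Prod>l\<in>A. lin (y l)) d = 0"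
  using assms
proof (induction A arbitrary: d rule: finite_induct)
  case (insert l A)
  then obtain d' where d: "d = Suc d'" by (cases d) auto
  have "fps_nth (fps_const (y l) * fps_X * (\<Prod>l\<in>A. lin (y l))) d =
    y l * fps_nth (\<Prod>l\<in>A. lin (y l)) d'"
    by (simp add: d mult.assoc)
  then show ?case using insert d by (simp add: left_diff_distrib)
qed auto

lemma fps_nth_prod_lin_0: "fps_nth (\<Prod>l\<in>A. lin (y l)) 0 = 1"
  by (induction A rule: infinite_finite_induct) simp_all

lemma prod_geom_lin: "(\<Prod>l\<in>A. geom (y l)) * (\<Prod>l\<in>A. lin (y l)) = 1"
  by (simp only: prod.distrib[symmetric] geom_lin prod.neutral_const)

text \<open>Multiplication by the unitriangular matrix of the coefficients of \<open>\<Prod>\<^bsub>l<j\<^esub> (1 - y\<^sub>lq)\<close>, one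
  product for each column \<open>j\<close>, turns entry \<open>(i, j)\<close> into the coefficient of degree \<open>n - 2i + j\<close> of
  \<open>\<Prod>\<^bsub>l<j\<^esub> (1 - y\<^sub>lq) / \<Prod>\<^bsub>l\<le>i\<^esub> (1 - y\<^sub>lq)\<close>. Above the diagonal this is a polynomial of too
  small a degree; on the diagonal it is the geometric series of \<open>y\<^sub>i\<close>.\<close>

lemma row_det_staircase:
  fixes y :: "nat \<Rightarrow> 'r::comm_ring_1"
  shows "row_det n (\<lambda>i. fps_X ^ (2 * i) * (\<Prod>l=1..i. geom (y l))) = (\<Prod>i=1..<n. y i ^ (n - i))"
proof -
  let ?N = "n - 1"
  define R where "R = (\<lambda>i. fps_X ^ (2 * i) * (\<Prod>l=1..i. geom (y l)))"
  define L where "L = (\<lambda>b. \<Prod>l=1..b. lin (y l))"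
  define M where "M = mat ?N ?N (\<lambda>(a, b). fps_nth (R (Suc a)) (n + Suc b))"
  define C where "C = mat ?N ?N (\<lambda>(k, b). if k \<le> b then fps_nth (L b) (b - k) else 0)"
  have dims: "M \<in> carrier_mat ?N ?N" "C \<in> carrier_mat ?N ?N" by (auto simp: M_def C_def)
  have L0: "fps_nth (L b) d = 0" if "b < d" for b d
    unfolding L_def by (rule fps_nth_prod_lin_eq_0) (use that in auto)
  have MC: "(M * C) $$ (a, b) = fps_nth (R (Suc a) * L b) (n + Suc b)" if "a < ?N" "b < ?N" for a b
  proof -
    have "fps_nth (R (Suc a) * L b) (n + Suc b) =
      (\<Sum>i=0..n + Suc b. fps_nth (R (Suc a)) i * fps_nth (L b) (n + Suc b - i))"
      by (simp add: fps_mult_nth)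
    also have "\<dots> = (\<Sum>i=n + Suc 0..n + Suc b. fps_nth (R (Suc a)) i * fps_nth (L b) (n + Suc b - i))"
      by (rule sum.mono_neutral_right) (auto simp: L0)
    also have "\<dots> = (\<Sum>k=0..b. fps_nth (R (Suc a)) (n + Suc k) * fps_nth (L b) (b - k))"
      by (rule sum.reindex_bij_witness[of _ "\<lambda>k. n + Suc k" "\<lambda>i. i - Suc n"]) (auto simp: add.commute)
    also have "\<dots> = (\<Sum>k=0..<?N. fps_nth (R (Suc a)) (n + Suc k) *
        (if k \<le> b then fps_nth (L b) (b - k) else 0))"
      by (rule sum.mono_neutral_cong_left) (use that in auto)
    finally show ?thesis using that dims by (simp add: M_def C_def scalar_prod_def)
  qed
  have above: "(M * C) $$ (a, b) = 0" if "a < b" "b < ?N" for a b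
  proof -
    have "{1..b} = {1..Suc a} \<union> {Suc (Suc a)..b}" using that by auto
    then have "L b = (\<Prod>l=1..Suc a. lin (y l)) * (\<Prod>l=Suc (Suc a)..b. lin (y l))"
      unfolding L_def by (simp add: prod.union_disjoint)
    then have "R (Suc a) * L b = fps_X ^ (2 * Suc a) *
      (((\<Prod>l=1..Suc a. geom (y l)) * (\<Prod>l=1..Suc a. lin (y l))) * (\<Prod>l=Suc (Suc a)..b. lin (y l)))"
      by (simp only: R_def mult.assoc)
    then have "R (Suc a) * L b = fps_X ^ (2 * Suc a) * (\<Prod>l=Suc (Suc a)..b. lin (y l))"
      by (simp only: prod_geom_lin mult_1)
    moreover have "fps_nth (\<Prod>l=Suc (Suc a)..b. lin (y l)) (n + Suc b - 2 * Suc a) = 0"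
      by (rule fps_nth_prod_lin_eq_0) (use that in auto)
    ultimately show ?thesis
      using that MC[of a b] by (simp only: fps_X_power_mult_nth) simp
  qed
  have diag: "(M * C) $$ (a, a) = y (Suc a) ^ (n - Suc a)" if "a < ?N" for a
  proof -
    have "R (Suc a) * L a = fps_X ^ (2 * Suc a) *
      (((\<Prod>l=1..a. geom (y l)) * L a) * geom (y (Suc a)))"
      unfolding R_def by (simp add: mult.assoc mult.left_commute mult.commute[of _ "L a"])
    then have "R (Suc a) * L a = fps_X ^ (2 * Suc a) * geom (y (Suc a))"
      by (simp only: prod_geom_lin L_def mult_1)
    then show ?thesis
      using that MC[of a a] by (simp only: fps_X_power_mult_nth geom_nth) simp
  qed
  have "Determinant.det C = 1"
    using det_upper_triangular[OF _ dims(2)]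
    by (auto simp: upper_triangular_def C_def prod_list_diag_prod L_def fps_nth_prod_lin_0 intro!: prod.neutral)
  moreover have "Determinant.det (M * C) = (\<Prod>a=0..<?N. y (Suc a) ^ (n - Suc a))"
    using det_lower_triangular[of ?N "M * C"] dims above diag
    by (auto simp: prod_list_diag_prod intro!: prod.cong)
  moreover have "(\<Prod>a=0..<?N. y (Suc a) ^ (n - Suc a)) = (\<Prod>i=1..<n. y i ^ (n - i))"
    by (rule prod.reindex_bij_witness[of _ "\<lambda>i. i - 1" Suc]) auto
  ultimately show ?thesis
    using det_mult[OF dims] by (simp add: row_det_def M_def R_def)
qed

text \<open>The row operation that trades a divided difference for a new variable \<open>z\<close>. After clearing
  denominators it reads \<open>(1 - zq)(1 - yq + zq) = (1 - yq) + z(y - z)q\<^sup>2\<close>.\<close>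

lemma geom_pair_identity:
  "1 + fps_const z * fps_X * geom y =
     geom z + fps_const (z * (y - z)) * fps_X\<^sup>2 * (geom y * geom z)"
proof -
  let ?X = "fps_X :: 'a fps" and ?y = "fps_const y" and ?z = "fps_const z"
  have "geom z + fps_const (z * (y - z)) * ?X\<^sup>2 * (geom y * geom z) =
    (geom y * lin y) * geom z + ?z * (?y - ?z) * ?X\<^sup>2 * (geom y * geom z)"
    by (simp only: geom_lin mult_1 fps_const_mult[symmetric] fps_const_sub[symmetric])
  also have "\<dots> = (geom z * lin z) * (geom y * lin y + ?z * ?X * geom y)"
    by (simp add: algebra_simps power2_eq_square del: fps_const_mult fps_const_sub fps_const_add)
  also have "\<dots> = 1 + ?z * ?X * geom y"
    by (simp only: geom_lin mult_1)
  finally show ?thesis by (rule sym)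
qed

lemma det_schubert_matrix:
  "Determinant.det (schubert_matrix n) =
    row_det n (\<lambda>i. fps_X ^ (2 * i) * ((\<Prod>l=1..i. geom (Yv l)) * (\<Prod>l=1..i. geom (- Zv l))))"
  unfolding row_det_def schubert_matrix_def
proof (intro arg_cong[of _ _ Determinant.det] cong_mat refl)
  fix a b assume ab: "a < n - 1" "b < n - 1"
  let ?i = "Suc a" and ?j = "Suc b"
  have pl: "prod_list (map f [1..<Suc i]) = prod f {1..i}" for f :: "nat \<Rightarrow> yz_poly fps" and i
    using prod.distinct_set_conv_list[of "[1..<Suc i]" f]
    by (simp only: set_upt distinct_upt atLeastLessThanSuc_atLeastAtMost)
  have H: "prod_list (map geom (YnegZ ?i)) = (\<Prod>l=1..?i. geom (Yv l)) * (\<Prod>l=1..?i. geom (- Zv l))"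
    unfolding YnegZ_def using pl[of "\<lambda>l. geom (Yv l)" ?i] pl[of "\<lambda>l. geom (- Zv l)" ?i]
    by (simp add: comp_def del: upt_Suc)
  have "complete_hom (int n - int ?i + int ?j - int ?i) (YnegZ ?i) =
    fps_nth (fps_X ^ (2 * ?i) * prod_list (map geom (YnegZ ?i))) (n + ?j)"
  proof (cases "n + ?j < 2 * ?i")
    case True
    then show ?thesis by (simp only: fps_X_power_mult_nth) (simp add: complete_hom_def)
  next
    case False
    then have "int n - int ?i + int ?j - int ?i = int (n + ?j - 2 * ?i)"
      by (subst of_nat_diff) auto
    then show ?thesis using False by (simp only: complete_hom_geom fps_X_power_mult_nth if_False)
  qed
  then show "(case (a, b) of (a, b) \<Rightarrow> let i = a + 1; j = b + 1
      in complete_hom (int n - int i + int j - int i) (YnegZ i)) =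
    (case (a, b) of (a, b) \<Rightarrow> fps_nth (fps_X ^ (2 * Suc a) *
      ((\<Prod>l=1..Suc a. geom (Yv l)) * (\<Prod>l=1..Suc a. geom (- Zv l)))) (n + Suc b))"
    unfolding H by (simp only: prod.case Let_def Suc_eq_plus1)
qed

section \<open>The longest permutation\<close>

definition staircase_word :: "nat \<Rightarrow> nat list" where
  "staircase_word n = concat (map (\<lambda>i. desc_word i n) [1..<n])"

lemma word_perm_staircase: "word_perm (staircase_word n) = longest_perm n"
proof (cases "n = 0")
  case True
  then show ?thesis by (simp add: staircase_word_def longest_perm_def fun_eq_iff)
next
  case False
  have "word_perm (concat (map (\<lambda>i. desc_word i n) [k..<n])) =
    (\<lambda>j. if k \<le> j \<and> j \<le> n then n + k - j else j)" if "k \<le> n" for k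
    using that
  proof (induction k rule: inc_induct)
    case base
    then show ?case by (auto simp: fun_eq_iff)
  next
    case (step k)
    obtain m where n: "n = Suc m" using False by (cases n) auto
    have "[k..<n] = k # [Suc k..<n]" using step by (simp add: upt_conv_Cons)
    then have "word_perm (concat (map (\<lambda>i. desc_word i n) [k..<n])) =
      word_perm (desc_word k n) \<circ> word_perm (concat (map (\<lambda>i. desc_word i n) [Suc k..<n]))"
      by simp
    also have "word_perm (desc_word k n) =
      (\<lambda>j. if j = k then n else if k < j \<and> j \<le> n then j - 1 else j)"
      unfolding n by (rule word_perm_desc) (use step n in auto)
    finally show ?case using step by (auto simp: fun_eq_iff)
  qed
  from this[of 1] False show ?thesis
    by (simp add: staircase_word_def longest_perm_def)
qed

definition inversions :: "nat \<Rightarrow> (nat \<Rightarrow> nat) \<Rightarrow> (nat \<times> nat) set" where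
  "inversions n w = {(i, j). 1 \<le> i \<and> i < j \<and> j \<le> n \<and> w j < w i}"

lemma finite_inversions: "finite (inversions n w)"
  by (rule finite_subset[of _ "{1..n} \<times> {1..n}"]) (auto simp: inversions_def)

text \<open>A simple transposition on the left creates at most one inversion, at the two positions whose
  values it exchanges.\<close>

lemma card_inversions_le: "card (inversions n (word_perm as)) \<le> length as"
proof (induction as)
  case Nil
  have "inversions n id = {}" by (auto simp: inversions_def)
  then show ?case by (simp only: word_perm_Nil card.empty le0)
next
  case (Cons a as)
  let ?w = "word_perm as"
  let ?p = "(Hilbert_Choice.inv ?w a, Hilbert_Choice.inv ?w (Suc a))"
  have inj: "inj ?w" using word_perm_bij bij_is_inj by blast
  have "inversions n (word_perm (a # as)) \<subseteq> insert ?p (inversions n ?w)"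
  proof clarify
    fix i j
    assume ij: "(i, j) \<in> inversions n (word_perm (a # as))" and new: "(i, j) \<notin> inversions n ?w"
    have "?w i < ?w j"
      using ij new injD[OF inj, of i j] by (force simp: inversions_def)
    moreover have "Transposition.transpose a (Suc a) (?w j) < Transposition.transpose a (Suc a) (?w i)"
      using ij by (simp add: inversions_def)
    ultimately have "?w i = a" "?w j = Suc a"
      by (auto simp: Transposition.transpose_def split: if_splits)
    then have "Hilbert_Choice.inv ?w a = i" "Hilbert_Choice.inv ?w (Suc a) = j"
      using inv_f_f[OF inj, of i] inv_f_f[OF inj, of j] by simp_all
    then show "i = Hilbert_Choice.inv ?w a \<and> j = Hilbert_Choice.inv ?w (Suc a)" by simp
  qed
  from card_mono[OF _ this] have "card (inversions n (word_perm (a # as))) \<le> card (insert ?p (inversions n ?w))"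
    using finite_inversions by blast
  also have "\<dots> \<le> Suc (card (inversions n ?w))"
    by (rule card_insert_le_m1) simp_all
  also have "\<dots> \<le> length (a # as)" using Cons by simp
  finally show ?case .
qed

lemma card_inversions_longest: "card (inversions n (longest_perm n)) = length (staircase_word n)"
proof -
  have "inversions n (longest_perm n) = (SIGMA i:{1..<n}. {i<..n})"
    by (auto simp: inversions_def longest_perm_def)
  moreover have "length (staircase_word n) = (\<Sum>i\<leftarrow>[1..<n]. n - i)"
    by (simp add: staircase_word_def length_concat comp_def desc_word_def)
  ultimately show ?thesis
    by (simp add: sum_list_distinct_conv_sum_set)
qed

text \<open>The word has as many letters as the longest permutation has inversions, so no word can be shorter.\<close>

lemma reduced_staircase_word: "reduced_word n (longest_perm n) (staircase_word n)"
proof -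
  have s: "set (staircase_word n) \<subseteq> {1..<n}" by (auto simp: staircase_word_def)
  then have "longest_perm n \<in> symgrp n"
    using word_perm_in_symgrp[OF s] by (simp add: word_perm_staircase)
  then obtain as where "reduced_word n (longest_perm n) as" using ex_reduced_word by blast
  then have "length (staircase_word n) \<le> perm_length n (longest_perm n)"
    using card_inversions_le[of n as] by (simp add: reduced_word_def card_inversions_longest)
  then show ?thesis
    using s perm_length_le[OF s] by (simp add: reduced_word_def word_perm_staircase)
qed

text \<open>Only the choice of the generator in every factor gives a word of full length. For the longest
  permutation, all shorter words are irrelevant.\<close>

lemma prod_factor_top_term:
  "\<exists>r. prod_list (map (\<lambda>(t, j). factor t j) cs) = mon (prod_list (map fst cs)) (map snd cs) + r \<and>
     (\<forall>a\<in>Poly_Mapping.keys r. length (letters a) < length cs)"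
proof (induction cs)
  case Nil
  show ?case
    by (intro exI[of _ 0]) (simp add: zero_gen_word_def[symmetric])
next
  case (Cons c cs)
  obtain t j where c: "c = (t, j)" by (cases c)
  let ?m = "mon (prod_list (map fst cs)) (map snd cs)"
  obtain r where r: "prod_list (map (\<lambda>(t, j). factor t j) cs) = ?m + r"
    "\<forall>a\<in>Poly_Mapping.keys r. length (letters a) < length cs" using Cons by blast
  let ?r = "?m + r + mon t [j] * r"
  have "prod_list (map (\<lambda>(t, j). factor t j) (c # cs)) = factor t j * (?m + r)"
    by (simp add: c r(1))
  also have "\<dots> = mon (prod_list (map fst (c # cs))) (map snd (c # cs)) + ?r"
    by (simp add: c factor_single distrib_left distrib_right mon_mult ac_simps)
  finally have "prod_list (map (\<lambda>(t, j). factor t j) (c # cs)) =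
    mon (prod_list (map fst (c # cs))) (map snd (c # cs)) + ?r" .
  moreover have "length (letters a) < length (c # cs)" if "a \<in> Poly_Mapping.keys ?r" for a
  proof -
    have "a \<in> Poly_Mapping.keys ?m \<or> a \<in> Poly_Mapping.keys r \<or> a \<in> Poly_Mapping.keys (mon t [j] * r)"
      using that subsetD[OF Poly_Mapping.keys_add[of "?m + r" "mon t [j] * r"], of a]
        subsetD[OF Poly_Mapping.keys_add[of ?m r], of a] by blast
    moreover have "\<exists>b\<in>Poly_Mapping.keys r. a = Word [j] + b" if "a \<in> Poly_Mapping.keys (mon t [j] * r)"
      using that subsetD[OF Poly_Mapping.keys_mult[of "mon t [j]" r], of a]
      by (auto split: if_splits)
    ultimately show ?thesis
      using r(2) by (fastforce simp: plus_gen_word_def split: if_splits)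
  qed
  ultimately show ?case by blast
qed

lemma word_coeff_prod_factor_top:
  assumes "length cs \<le> perm_length n w" "reduced_word n w (map snd cs)"
  shows "word_coeff n w (prod_list (map (\<lambda>(t, j). factor t j) cs)) = prod_list (map fst cs)"
proof -
  obtain r where r: "prod_list (map (\<lambda>(t, j). factor t j) cs) =
      mon (prod_list (map fst cs)) (map snd cs) + r"
    "\<forall>a\<in>Poly_Mapping.keys r. length (letters a) < length cs" using prod_factor_top_term by blast
  have "word_coeff n w r = 0"
    unfolding word_coeff_def
    by (rule sum.neutral) (use r(2) assms(1) in \<open>auto simp: reduced_word_def\<close>)
  then show ?thesis using assms(2) by (simp add: r(1) word_coeff_single)
qed

lemma word_coeff_longest_schubert_elt:
  "word_coeff n (longest_perm n) (schubert_elt n y) = (\<Prod>i=1..<n. y i ^ (n - i))"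
proof -
  let ?cs = "concat (map (\<lambda>i. map (Pair (y i)) (desc_word i n)) [1..<n])"
  have snd: "map snd ?cs = staircase_word n"
    by (simp add: staircase_word_def map_concat comp_def)
  have "schubert_elt n y = prod_list (map (\<lambda>(t, j). factor t j) ?cs)"
  proof -
    have "prod_list (map (\<lambda>(t, j). factor t j) (concat (map (\<lambda>i. map (Pair (y i)) (desc_word i n)) is))) =
      prod_list (map (\<lambda>i. factors (y i) (desc_word i n)) is)" for "is"
      by (induction "is") (simp_all add: factors_def comp_def)
    then show ?thesis by (simp add: schubert_elt_def)
  qed
  moreover have "reduced_word n (longest_perm n) (map snd ?cs)"
    unfolding snd by (rule reduced_staircase_word)
  moreover have "length ?cs \<le> perm_length n (longest_perm n)"
    using calculation(2) unfolding reduced_word_def by (simp only: length_map)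
  ultimately have "word_coeff n (longest_perm n) (schubert_elt n y) = prod_list (map fst ?cs)"
    by (simp only: word_coeff_prod_factor_top)
  also have "\<dots> = prod_list (map (\<lambda>i. y i ^ (n - i)) [1..<n])"
  proof -
    have "prod_list (map fst (concat (map (\<lambda>i. map (Pair (y i)) (desc_word i n)) is))) =
      prod_list (map (\<lambda>i. y i ^ (n - i)) is)" for "is"
      by (induction "is") (simp_all add: comp_def map_replicate_const desc_word_def)
    then show ?thesis .
  qed
  also have "\<dots> = (\<Prod>i=1..<n. y i ^ (n - i))"
    using prod.distinct_set_conv_list[of "[1..<n]" "\<lambda>i. y i ^ (n - i)"]
    by (simp only: set_upt distinct_upt)
  finally show ?thesis .
qed

section \<open>Determinants for the longest permutation\<close>

abbreviation geom_prod :: "(nat \<Rightarrow> 'r) \<Rightarrow> nat \<Rightarrow> 'r::comm_ring_1 fps" where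
  "geom_prod x i \<equiv> \<Prod>l=1..i. geom (x l)"

text \<open>The divided difference of the geometric series \<open>1 / (1 - yq)\<close> is \<open>q / ((1 - aq)(1 - bq))\<close>: it
  adds a variable and shifts the degree.\<close>

lemma geom_diff: "geom a - geom b = fps_const (a - b) * (fps_X * (geom a * geom b))"
proof -
  have "geom a - geom b = geom a * (geom b * lin b) - geom b * (geom a * lin a)"
    by (simp only: geom_lin mult_1_right)
  also have "\<dots> = (fps_const a - fps_const b) * (fps_X * (geom a * geom b))"
    by (simp add: algebra_simps del: fps_const_sub)
  finally show ?thesis by simp
qed

lemma geom_prod_Suc: "geom_prod x (Suc i) = geom_prod x i * geom (x (Suc i))"
  by simp

lemma geom_prod_swap:
  assumes "1 \<le> k" "i \<noteq> k"
  shows "geom_prod (y \<circ> Transposition.transpose k (Suc k)) i = geom_prod y i"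
proof (cases "i < k")
  case True
  then show ?thesis by (intro prod.cong) (auto simp: Transposition.transpose_def)
next
  case False
  then have "Transposition.transpose k (Suc k) permutes {1..i}"
    using assms by (intro permutes_swap_id) auto
  from prod.permute[OF this, of "\<lambda>l. geom (y l)"] show ?thesis by (simp add: comp_def)
qed

text \<open>The induction on \<open>m\<close> inserts the factors \<open>1 + z\<^bsub>m+1\<^esub>u\<^sub>k\<close> for \<open>k = n - 1, \<dots>, m + 1\<close>, each to the
  left of the previous ones. In that order row \<open>k\<close> is the only row that is not symmetric in \<open>y\<^sub>k\<close>
  and \<open>y\<^bsub>k+1\<^esub>\<close> when \<open>u\<^sub>k\<close> acts: the rows above involve neither variable, and the rows below involve
  both symmetrically. The divided difference hence acts on that row alone. When all factors are in,
  unitriangular row operations restore the shape of the determinant with \<open>z\<^bsub>m+1\<^esub>\<close> as a new variable.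

  Division by \<open>y\<^sub>k - y\<^bsub>k+1\<^esub>\<close> is why the \<open>y\<^sub>i\<close> are distinct elements of a domain; the statement
  is proved for all such \<open>y\<close> at once since \<open>y\<^sub>k\<close> and \<open>y\<^bsub>k+1\<^esub>\<close> get exchanged.\<close>

theorem word_coeff_longest_dual:
  fixes y z :: "nat \<Rightarrow> 'r::idom"
  assumes "inj y" "m < n"
  shows "word_coeff n (longest_perm n) (schubert_elt n y * dual_elt n z m) =
    row_det n (\<lambda>i. fps_X ^ (2 * i) * (geom_prod y i * geom_prod z (min i m)))"
  using assms
proof (induction m arbitrary: y)
  case 0
  show ?case
    using row_det_staircase[of n y] by (simp add: word_coeff_longest_schubert_elt)
next
  case (Suc m)
  let ?W = "word_coeff n (longest_perm n)"
  define t where "t = z (Suc m)"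
  define g where "g = dual_elt n z m"
  define P where "P = (\<lambda>i. geom_prod z (min i m))"
  \<comment> \<open>The rows after the factors with indices at least \<open>k\<close> have been inserted.\<close>
  define T where "T = (\<lambda>(y :: nat \<Rightarrow> 'r) k i. fps_X ^ (2 * i) * (geom_prod y i * P i) +
    (if k \<le> i then fps_const t * (fps_X ^ Suc (2 * i) * (geom_prod y (Suc i) * P i)) else 0))"
  have partial: "?W (schubert_elt n y * (factors t [k..<n] * g)) = row_det n (T y k)"
    if "k \<le> n" "Suc m \<le> k" "inj y" for k y
    using that
  proof (induction k arbitrary: y rule: inc_induct)
    case base
    have "row_det n (T y n) = row_det n (\<lambda>i. fps_X ^ (2 * i) * (geom_prod y i * P i))"
      by (rule row_det_cong) (simp add: T_def)
    then show ?case
      using Suc.IH[OF base(2)] Suc.prems by (simp add: g_def P_def)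
  next
    case (step k)
    have k: "1 \<le> k" "k < n" using step by auto
    let ?y' = "y \<circ> Transposition.transpose k (Suc k)"
    define \<xi> where "\<xi> = factors t [Suc k..<n] * g"
    define Q where "Q = fps_X ^ Suc (2 * k) * (geom_prod y (Suc k) * P k)"
    define R where "R = T y (Suc k)"
    have inj': "inj ?y'" using step by (intro inj_compose) auto
    have IH: "?W (schubert_elt n x * \<xi>) = row_det n (T x (Suc k))" if "inj x" for x
      unfolding \<xi>_def using step.IH[of x] step that by simp
    have prev: "T ?y' (Suc k) = R(k := T ?y' (Suc k) k)"
    proof
      fix i
      show "T ?y' (Suc k) i = (R(k := T ?y' (Suc k) k)) i"
        using geom_prod_swap[OF k(1), of i y] geom_prod_swap[OF k(1), of "Suc i" y]
        by (cases "i = k") (simp_all only: T_def R_def fun_upd_apply if_True if_False not_less_eq_eq refl split: if_split, auto)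
    qed
    have row: "R k = T ?y' (Suc k) k + fps_const (y k - y (Suc k)) * Q"
    proof -
      obtain j where j: "k = Suc j" using k by (cases k) auto
      have "geom_prod ?y' j = geom_prod y j" using geom_prod_swap[OF k(1), of j y] j by simp
      then have "geom_prod y k - geom_prod ?y' k = geom_prod y j * (geom (y k) - geom (y (Suc k)))"
        unfolding j geom_prod_Suc by (simp add: right_diff_distrib)
      also have "\<dots> = fps_const (y k - y (Suc k)) * (fps_X * geom_prod y (Suc k))"
        unfolding geom_diff geom_prod_Suc j by (simp only: mult_ac)
      finally have "geom_prod y k = geom_prod ?y' k + fps_const (y k - y (Suc k)) * (fps_X * geom_prod y (Suc k))"
        by (simp only: diff_eq_eq add.commute)
      then have "R k = fps_X ^ (2 * k) * ((geom_prod ?y' k +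
          fps_const (y k - y (Suc k)) * (fps_X * geom_prod y (Suc k))) * P k)"
        by (simp only: R_def T_def) simp
      then show ?thesis
        by (simp only: T_def Q_def power_Suc distrib_left distrib_right mult_ac) simp
    qed
    have "(y k - y (Suc k)) * ?W (schubert_elt n y * (word_elt [k] * \<xi>)) =
      row_det n R - row_det n (R(k := T ?y' (Suc k) k))"
      using schubert_elt_difference[OF k, of y "longest_perm n" \<xi>] IH[OF step.prems(2)] IH[OF inj'] prev
      by (simp only: R_def)
    also have "row_det n R = row_det n (R(k := T ?y' (Suc k) k)) + (y k - y (Suc k)) * row_det n (R(k := Q))"
      using row_det_add[OF k, of R "T ?y' (Suc k) k" "fps_const (y k - y (Suc k)) * Q"]
        row_det_scale[OF k, of R "y k - y (Suc k)" Q] row by (metis fun_upd_triv)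
    finally have "(y k - y (Suc k)) * ?W (schubert_elt n y * (word_elt [k] * \<xi>)) =
      (y k - y (Suc k)) * row_det n (R(k := Q))" by (simp only: add_diff_cancel_left')
    moreover have "y k - y (Suc k) \<noteq> 0" using injD[OF step.prems(2), of k "Suc k"] by auto
    ultimately have W: "?W (schubert_elt n y * (word_elt [k] * \<xi>)) = row_det n (R(k := Q))" by simp
    have "factors t [k..<n] * g = \<xi> + scalar t * (word_elt [k] * \<xi>)"
      using k by (simp add: upt_conv_Cons factors_Cons \<xi>_def factor_def distrib_right mult.assoc del: upt_Suc)
    then have "schubert_elt n y * (factors t [k..<n] * g) =
      schubert_elt n y * \<xi> + (schubert_elt n y * scalar t) * (word_elt [k] * \<xi>)"
      by (simp only: distrib_left mult.assoc)
    then have "?W (schubert_elt n y * (factors t [k..<n] * g)) =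
      ?W (schubert_elt n y * \<xi>) + t * ?W (schubert_elt n y * (word_elt [k] * \<xi>))"
      by (simp only: scalar_commute[symmetric] mult.assoc word_coeff_add word_coeff_scalar)
    also have "\<dots> = row_det n R + t * row_det n (R(k := Q))"
      by (simp only: W IH[OF step.prems(2)] R_def)
    also have "\<dots> = row_det n (R(k := R k + fps_const t * Q))"
      by (simp only: row_det_add[OF k] row_det_scale[OF k] fun_upd_triv)
    also have "R(k := R k + fps_const t * Q) = T y k"
      by (auto simp: fun_eq_iff R_def T_def Q_def)
    finally show ?case .
  qed
  have "row_det n (T y (Suc m)) =
    row_det n (\<lambda>i. fps_X ^ (2 * i) * (geom_prod y i * geom_prod z (min i (Suc m))))"
  proof (rule row_det_unitriangular[where c = "\<lambda>i. if Suc m \<le> i then t * (y (Suc i) - t) else 0"])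
    fix i assume "1 \<le> i" "i < n"
    show "T y (Suc m) i = fps_X ^ (2 * i) * (geom_prod y i * geom_prod z (min i (Suc m))) +
      fps_const (if Suc m \<le> i then t * (y (Suc i) - t) else 0) *
      (fps_X ^ (2 * Suc i) * (geom_prod y (Suc i) * geom_prod z (min (Suc i) (Suc m))))"
    proof (cases "Suc m \<le> i")
      case True
      let ?H = "fps_X ^ (2 * i) * (geom_prod y i * geom_prod z m)"
      have "T y (Suc m) i = ?H * (1 + fps_const t * fps_X * geom (y (Suc i)))"
        using True by (simp only: T_def P_def geom_prod_Suc) (simp add: algebra_simps)
      also have "\<dots> = ?H * (geom t + fps_const (t * (y (Suc i) - t)) * fps_X\<^sup>2 * (geom (y (Suc i)) * geom t))"
        by (simp only: geom_pair_identity)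
      also have "\<dots> = fps_X ^ (2 * i) * (geom_prod y i * geom_prod z (Suc m)) +
        fps_const (t * (y (Suc i) - t)) *
          (fps_X ^ (2 * Suc i) * (geom_prod y (Suc i) * geom_prod z (Suc m)))"
      proof -
        have "(fps_X :: 'r fps) ^ (2 * Suc i) = fps_X ^ (2 * i) * fps_X\<^sup>2"
          by (simp add: power2_eq_square mult.assoc)
        then show ?thesis
          unfolding geom_prod_Suc t_def[symmetric] by (simp only: distrib_left mult_ac)
      qed
      finally show ?thesis using True by simp
    next
      case False
      then show ?thesis by (simp add: T_def P_def min_def)
    qed
  next
    fix j assume "j < n"
    then show "fps_nth (fps_X ^ (2 * n) * (geom_prod y n * geom_prod z (min n (Suc m)))) (n + j) = 0"
      by (simp only: fps_X_power_mult_nth) simp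
  qed
  then show ?case
    using partial[of "Suc m" y] Suc.prems by (simp add: t_def g_def)
qed

section \<open>The polynomial ring in two families of variables\<close>

text \<open>Any linear order of the variables will do: it makes the monomials an ordered monoid, by which the
  polynomial ring is known to be a domain.\<close>

instantiation yz_var :: linorder
begin

definition less_eq_yz_var :: "yz_var \<Rightarrow> yz_var \<Rightarrow> bool" where
  "less_eq_yz_var u v = (case (u, v) of
     (YVar i, YVar j) \<Rightarrow> i \<le> j | (YVar i, ZVar j) \<Rightarrow> True
   | (ZVar i, YVar j) \<Rightarrow> False | (ZVar i, ZVar j) \<Rightarrow> i \<le> j)"

definition less_yz_var :: "yz_var \<Rightarrow> yz_var \<Rightarrow> bool" where
  "less_yz_var u v \<longleftrightarrow> u \<le> v \<and> \<not> v \<le> u"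

instance
  by standard (auto simp: less_eq_yz_var_def less_yz_var_def split: yz_var.splits)

end

lemma inj_Yv: "inj Yv"
proof (rule injI)
  fix i j assume "Yv i = Yv j"
  then have "Poly_Mapping.lookup (Yv i) (Poly_Mapping.single (YVar i) 1) =
    Poly_Mapping.lookup (Yv j) (Poly_Mapping.single (YVar i) 1)" by simp
  then have "Poly_Mapping.single (YVar i) (1 :: nat) = Poly_Mapping.single (YVar j) 1"
    by (simp add: Yv_def lookup_single when_def split: if_splits)
  then have "Poly_Mapping.keys (Poly_Mapping.single (YVar i) (1 :: nat)) =
    Poly_Mapping.keys (Poly_Mapping.single (YVar j) (1 :: nat))" by simp
  then show "i = j" by simp
qed

theorem corollary2p6:
  fixes n :: nat
  assumes "n \<ge> 1"
  shows "rev_double_schubert n (longest_perm n) Yv Zv = Determinant.det (schubert_matrix n)"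
proof -
  have "rev_double_schubert n (longest_perm n) Yv Zv =
    row_det n (\<lambda>i. fps_X ^ (2 * i) *
      (geom_prod Yv i * geom_prod (\<lambda>i. - Zv i) (min i (n - 1))))"
    unfolding rev_double_schubert_eq
    by (rule word_coeff_longest_dual[OF inj_Yv]) (use assms in simp)
  also have "\<dots> = row_det n (\<lambda>i. fps_X ^ (2 * i) *
      (geom_prod Yv i * geom_prod (\<lambda>i. - Zv i) i))"
    by (rule row_det_cong) (simp add: min_def)
  also have "\<dots> = Determinant.det (schubert_matrix n)"
    by (rule det_schubert_matrix[symmetric])
  finally show ?thesis .
qed

end
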